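(* Let $K$ be a field of characteristic zero, $U$ a finite-dimensional $K$-vector space, and let $L$ be the intersection lattice of a hyperplane arrangement $\mathcal{H}$ in $U^*$. Assume that the relation complex $V$ of $\mathcal{H}$ is $L$-contractible. Then the minimal complex associated to the defining ideals of $\mathcal{H}$, i.e. the minimal complex $\mathcal{O}\big(\mathrm{Sym}\,U,((H^\perp)_{\mathrm{Sym}\,U})_{H\in\mathcal{H}}\big)$, is exact, where $(H^\perp)_{\mathrm{Sym}\,U}$ is the ideal of $\mathrm{Sym}\,U$ generated by the line $H^\perp\subset U$ annihilating $H$.
   Context: Intersection lattice. $L$ is the set of all intersections of hyperplanes of $\mathcal{H}$ (with $U^*$ as minimal element $0$), ordered by reverse inclusion; it is a geometric lattice with rank = codimension and set of atoms $\mathbb{A}(L)=\mathcal{H}$. Put $n=\mathrm{rk}\,L$; $y\prec x$ means $x$ covers $y$; $L_{\le x}=\{y\in L:y\le x\}$. Compatible grading. A compatible $L$-grading on a chain complex of $R$-modules ($R$ a ring) $V_{n+1}=0\to V_n\to\dots\xrightarrow{\partial_i}V_{i-1}\to\dots\to V_0$ is given by submodules $V_x\subset V_{\mathrm{rk}(x)}$, $x\in L$, with $V_i=\bigoplus_{\mathrm{rk}(x)=i}V_x$ and $\partial(V_x)\subset\bigoplus_{y\prec x}V_y$ for $x\ne0$. Then $V_{\le x}=\bigoplus_{y\le x}V_y$ is a subcomplex graded by $L_{\le x}$. Exact means $\mathrm{Ker}\,\partial_i=\mathrm{Im}\,\partial_{i+1}$ for $i=1,\dots,n$ (surjectivity of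 $\partial_1$ is not required). Minimal complex. For a module $U_0$ with submodules $U_a$, $a\in\mathbb{A}(L)$, the minimal complex $\mathcal{O}(U_0,(U_a))$ is the unique compatibly $L$-graded complex $W$ with $W_0=U_0$; $W_a=U_a$ with $\partial|_{W_a}$ the inclusion $U_a\hookrightarrow U_0$; and for $\mathrm{rk}(x)=i>1$, $W_x=\mathrm{Ker}(\partial_{i-1}|_{\bigoplus_{y\prec x}W_y})$ with $\partial|_{W_x}$ the inclusion. Relation complex. The relation complex of $\mathcal{H}$ is the minimal complex $\mathcal{O}(U,(H^\perp)_{H\in\mathcal{H}})$. $L$-contractible. An $L$-homotopy for a compatibly $L$-graded complex $V$ is a sequence of morphisms $d_0:\mathrm{Im}\,\partial_1\to V_1$, $d_i:V_i\to V_{i+1}$ ($1\le i\le n$) with $d_{i-1}\partial_i+\partial_{i+1}d_i=\mathrm{id}_{V_i}$ for $1\le i\le n$ and $d_{\mathrm{rk}(x)}(V_x)\subset\bigoplus_{y\succ x}V_y$ for $x\ne0$. $V$ is $L$-contractible if for each $x\in L$ the $L_{\le x}$-graded complex $V_{\le x}$ admits an $L_{\le x}$-homotopy. *)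

theory Defs
  imports
    Complex_Main
    "HOL-Library.Function_Algebras"
    "HOL-Library.Poly_Mapping"
begin

section \<open>Ranked posets and graded chain complexes\<close>

text \<open>
  The leq relation of a ranked poset is a field of the record, since intersection lattices are
  ordered by reverse inclusion.
\<close>

record 'l ranked_poset =
  elts :: "'l set"
  leq :: "'l \<Rightarrow> 'l \<Rightarrow> bool"
  rk :: "'l \<Rightarrow> nat"

definition covered_by :: "'l ranked_poset \<Rightarrow> 'l \<Rightarrow> 'l \<Rightarrow> bool" where
  "covered_by L y x \<longleftrightarrow>
     y \<in> elts L \<and> x \<in> elts L \<and> leq L y x \<and> y \<noteq> x \<and>
     (\<forall>z\<in>elts L. leq L y z \<and> leq L z x \<longrightarrow> z = y \<or> z = x)"

definition total_rank :: "'l ranked_poset \<Rightarrow> nat" where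
  "total_rank L = Max (rk L ` elts L)"

definition below :: "'l ranked_poset \<Rightarrow> 'l \<Rightarrow> 'l ranked_poset" where
  "below L x = L\<lparr>elts := {y \<in> elts L. leq L y x}\<rparr>"

definition sum_sub :: "('l \<Rightarrow> 'c::comm_monoid_add set) \<Rightarrow> 'l set \<Rightarrow> 'c set" where
  "sum_sub V I = {\<Sum>x\<in>I. v x | v. \<forall>x\<in>I. v x \<in> V x}"

definition direct_sub :: "('l \<Rightarrow> 'c::comm_monoid_add set) \<Rightarrow> 'l set \<Rightarrow> bool" where
  "direct_sub V I \<longleftrightarrow>
     (\<forall>v. (\<forall>x\<in>I. v x \<in> V x) \<and> (\<Sum>x\<in>I. v x) = 0 \<longrightarrow> (\<forall>x\<in>I. v x = 0))"

text \<open>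
  All modules of a complex are submodules of one ambient module. A graded complex is given by the
  homogeneous components \<open>V\<^sub>x\<close> and the differentials \<open>\<partial>\<^sub>i\<close>, whose values matter only on the module
  \<open>V\<^sub>i = \<Oplus>\<^bsub>rk x = i\<^esub> V\<^sub>x\<close>. Restricting the index poset to \<open>L\<^sub>\<le>\<^sub>x\<close> with the same components and
  differentials yields the subcomplex \<open>V\<^sub>\<le>\<^sub>x\<close>.
\<close>

record ('l, 'c) graded_complex =
  component :: "'l \<Rightarrow> 'c set"
  diff :: "nat \<Rightarrow> 'c \<Rightarrow> 'c"

definition chain_module ::
    "'l ranked_poset \<Rightarrow> ('l, 'c::comm_monoid_add) graded_complex \<Rightarrow> nat \<Rightarrow> 'c set" where
  "chain_module L V i = sum_sub (component V) {x \<in> elts L. rk L x = i}"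

definition linear_between ::
    "('r \<Rightarrow> 'c \<Rightarrow> 'c) \<Rightarrow> 'c set \<Rightarrow> 'c set \<Rightarrow> ('c::ab_group_add \<Rightarrow> 'c) \<Rightarrow> bool" where
  "linear_between s M N f \<longleftrightarrow>
     (\<forall>v\<in>M. f v \<in> N) \<and>
     (\<forall>v\<in>M. \<forall>w\<in>M. f (v + w) = f v + f w) \<and>
     (\<forall>r. \<forall>v\<in>M. f (s r v) = s r (f v))"

definition compatibly_graded ::
    "('r::comm_ring_1 \<Rightarrow> 'c \<Rightarrow> 'c) \<Rightarrow> 'l ranked_poset \<Rightarrow>
     ('l, 'c::ab_group_add) graded_complex \<Rightarrow> bool" where
  "compatibly_graded s L V \<longleftrightarrow>
     (\<forall>x\<in>elts L. module.subspace s (component V x)) \<and>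
     (\<forall>i. direct_sub (component V) {x \<in> elts L. rk L x = i}) \<and>
     (\<forall>i\<ge>1. linear_between s (chain_module L V i) (chain_module L V (i - 1)) (diff V i)) \<and>
     (\<forall>i\<ge>1. \<forall>v\<in>chain_module L V (i + 1). diff V i (diff V (i + 1) v) = 0) \<and>
     (\<forall>x\<in>elts L. rk L x \<noteq> 0 \<longrightarrow>
        diff V (rk L x) ` component V x \<subseteq> sum_sub (component V) {y. covered_by L y x})"

text \<open>Surjectivity of \<open>\<partial>\<^sub>1\<close> is not part of exactness.\<close>

definition exact_complex ::
    "'l ranked_poset \<Rightarrow> ('l, 'c::comm_monoid_add) graded_complex \<Rightarrow> bool" where
  "exact_complex L V \<longleftrightarrow>
     (\<forall>i\<in>{1..total_rank L}.
        {v \<in> chain_module L V i. diff V i v = 0} = diff V (i + 1) ` chain_module L V (i + 1))"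

definition is_homotopy ::
    "('r \<Rightarrow> 'c \<Rightarrow> 'c) \<Rightarrow> 'l ranked_poset \<Rightarrow> ('l, 'c::ab_group_add) graded_complex \<Rightarrow>
     (nat \<Rightarrow> 'c \<Rightarrow> 'c) \<Rightarrow> bool" where
  "is_homotopy s L V d \<longleftrightarrow>
     linear_between s (diff V 1 ` chain_module L V 1) (chain_module L V 1) (d 0) \<and>
     (\<forall>i\<in>{1..total_rank L}.
        linear_between s (chain_module L V i) (chain_module L V (i + 1)) (d i)) \<and>
     (\<forall>i\<in>{1..total_rank L}. \<forall>v\<in>chain_module L V i.
        d (i - 1) (diff V i v) + diff V (i + 1) (d i v) = v) \<and>
     (\<forall>x\<in>elts L. rk L x \<noteq> 0 \<longrightarrow>
        d (rk L x) ` component V x \<subseteq> sum_sub (component V) {y. covered_by L x y})"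

definition contractible ::
    "('r \<Rightarrow> 'c \<Rightarrow> 'c) \<Rightarrow> 'l ranked_poset \<Rightarrow> ('l, 'c::ab_group_add) graded_complex \<Rightarrow> bool" where
  "contractible s L V \<longleftrightarrow> (\<forall>x\<in>elts L. \<exists>d. is_homotopy s (below L x) V d)"


section \<open>The minimal complex\<close>

text \<open>
  For \<open>rk x > 1\<close> the component \<open>W\<^sub>x\<close> of the minimal complex is a submodule of
  \<open>\<Oplus>\<^bsub>y \<prec> x\<^esub> W\<^sub>y\<close>, so an element of \<open>W\<^sub>x\<close> unfolds recursively to a family of elements of \<open>U\<^sub>0\<close>
  indexed by the chains \<open>x = x\<^sub>i \<succ> \<dots> \<succ> x\<^sub>1\<close> with \<open>rk x\<^sub>1 = 1\<close>. The ambient module therefore consists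
  of the functions from lists \<open>[x\<^sub>i, \<dots>, x\<^sub>1]\<close> to the module containing \<open>U\<^sub>0\<close>; an element \<open>u\<close> of \<open>U\<^sub>0\<close>
  is represented by \<open>at_nil u\<close>, and \<open>prepend x v\<close> is the copy in \<open>W\<^sub>x\<close> of the element \<open>v\<close> of
  \<open>\<Oplus>\<^bsub>y \<prec> x\<^esub> W\<^sub>y\<close>. The differential undoes \<open>prepend\<close>, that is, it is the inclusion on each \<open>W\<^sub>x\<close>.
\<close>

definition at_nil :: "'m \<Rightarrow> 'l list \<Rightarrow> 'm::zero" where
  "at_nil u = (\<lambda>c. if c = [] then u else 0)"

definition prepend :: "'l \<Rightarrow> ('l list \<Rightarrow> 'm) \<Rightarrow> 'l list \<Rightarrow> 'm::zero" where
  "prepend x v = (\<lambda>c. case c of [] \<Rightarrow> 0 | y # c' \<Rightarrow> if y = x then v c' else 0)"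

definition chain_diff ::
    "'l ranked_poset \<Rightarrow> ('l list \<Rightarrow> 'm) \<Rightarrow> 'l list \<Rightarrow> 'm::comm_monoid_add" where
  "chain_diff L w = (\<lambda>c. \<Sum>x\<in>elts L. w (x # c))"

fun minimal_component ::
    "'l ranked_poset \<Rightarrow> 'm::comm_monoid_add set \<Rightarrow> ('l \<Rightarrow> 'm set) \<Rightarrow> nat \<Rightarrow> 'l \<Rightarrow>
     ('l list \<Rightarrow> 'm) set" where
  "minimal_component L U\<^sub>0 U 0 x = at_nil ` U\<^sub>0"
| "minimal_component L U\<^sub>0 U (Suc 0) x = prepend x ` at_nil ` U x"
| "minimal_component L U\<^sub>0 U (Suc (Suc i)) x =
     prepend x ` {v \<in> sum_sub (minimal_component L U\<^sub>0 U (Suc i)) {y. covered_by L y x}.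
                    chain_diff L v = 0}"

definition minimal_complex ::
    "'l ranked_poset \<Rightarrow> 'm::comm_monoid_add set \<Rightarrow> ('l \<Rightarrow> 'm set) \<Rightarrow>
     ('l, 'l list \<Rightarrow> 'm) graded_complex" where
  "minimal_complex L U\<^sub>0 U =
     \<lparr>component = (\<lambda>x. minimal_component L U\<^sub>0 U (rk L x) x), diff = (\<lambda>_. chain_diff L)\<rparr>"

definition pointwise :: "('r \<Rightarrow> 'm \<Rightarrow> 'm) \<Rightarrow> 'r \<Rightarrow> ('a \<Rightarrow> 'm) \<Rightarrow> 'a \<Rightarrow> 'm" where
  "pointwise s r w = (\<lambda>c. s r (w c))"


lemma chain_diff_prepend: 
  assumes "finite (elts L)" "x \<in> elts L" shows "chain_diff L (prepend x v) = v"
proof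
  fix c
  have "(\<Sum>y\<in>elts L. if y = x then v c else 0) = v c" using assms by simp
  then show "chain_diff L (prepend x v) c = v c" by (simp add: chain_diff_def prepend_def)
qed

lemma module_pointwise: "module s \<Longrightarrow> module (pointwise s)"
  unfolding module_def pointwise_def by (auto simp: plus_fun_def)

lemma linear_chain_diff: "chain_diff L (v + w) = chain_diff L v + chain_diff L w" 
  "module s \<Longrightarrow> chain_diff L (pointwise s r v) = pointwise s r (chain_diff L v)"
  unfolding chain_diff_def pointwise_def plus_fun_def
  by (auto simp: sum.distrib module.scale_sum_right)

lemma chain_diff_sum: "chain_diff L (\<Sum>i\<in>I. f i) = (\<Sum>i\<in>I. chain_diff L (f i :: _ \<Rightarrow> _::comm_monoid_add))"
proof (induction I rule: infinite_finite_induct)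
  case (insert x F)
  have "chain_diff L (f x + sum f F) = chain_diff L (f x) + chain_diff L (sum f F)"
    by (auto simp: chain_diff_def plus_fun_def sum.distrib)
  then show ?case unfolding sum.insert[OF insert(1,2)] insert(3) .
qed (auto simp: chain_diff_def zero_fun_def)

lemma subspace_sum_sub:
  assumes "module s" "finite I" "\<And>x. x \<in> I \<Longrightarrow> module.subspace s (V x)"
  shows "module.subspace s (sum_sub V I)"
proof -
  interpret module s by fact
  show ?thesis
  proof (rule subspaceI)
    show "0 \<in> sum_sub V I" unfolding sum_sub_def using assms(3) subspace_0 
      by (auto intro!: exI[of _ "\<lambda>_. 0"])
    fix a b assume "a \<in> sum_sub V I" "b \<in> sum_sub V I"
    then show "a + b \<in> sum_sub V I" unfolding sum_sub_def 
    proof clarify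
      fix v w assume "\<forall>x\<in>I. v x \<in> V x" "\<forall>x\<in>I. w x \<in> V x"
      then show "\<exists>u. sum v I + sum w I = sum u I \<and> (\<forall>x\<in>I. u x \<in> V x)"
        using assms(3) subspace_add by (intro exI[of _ "\<lambda>x. v x + w x"]) (auto simp: sum.distrib)
    qed
  next
    fix c a assume "a \<in> sum_sub V I"
    then show "s c a \<in> sum_sub V I" unfolding sum_sub_def
    proof clarify
      fix v assume "\<forall>x\<in>I. v x \<in> V x"
      then show "\<exists>u. s c (sum v I) = sum u I \<and> (\<forall>x\<in>I. u x \<in> V x)"
        using assms(3) subspace_scale by (intro exI[of _ "\<lambda>x. s c (v x)"]) (auto simp: scale_sum_right)
    qed
  qed
qed

lemma prepend_add: "prepend x (v + w) = prepend x v + prepend x (w :: _ \<Rightarrow> _::comm_monoid_add)"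
  by (auto simp: prepend_def plus_fun_def fun_eq_iff split: list.splits)
lemma prepend_scale: "module s \<Longrightarrow> prepend x (pointwise s r v) = pointwise s r (prepend x v)"
  by (auto simp: prepend_def pointwise_def fun_eq_iff module.scale_zero_right split: list.splits)
lemma prepend_0: "prepend x 0 = 0"
  by (auto simp: prepend_def zero_fun_def fun_eq_iff split: list.splits)
lemma at_nil_add: "at_nil (v + w) = at_nil v + at_nil (w :: _::comm_monoid_add)"
  by (auto simp: at_nil_def plus_fun_def fun_eq_iff)
lemma at_nil_scale: "module s \<Longrightarrow> at_nil (s r v) = pointwise s r (at_nil v)"
  by (auto simp: at_nil_def pointwise_def fun_eq_iff module.scale_zero_right)
lemma at_nil_0: "at_nil 0 = 0"
  by (auto simp: at_nil_def zero_fun_def fun_eq_iff)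

lemma subspace_image: assumes "module s" "module t" "module.subspace s M" 
  "f 0 = 0" "\<And>v w. f (v+w) = f v + f w" "\<And>r v. f (s r v) = t r (f v)" 
  shows "module.subspace t (f ` M)"
proof -
  interpret S: module s by fact
  interpret T: module t by fact
  show ?thesis 
  proof (rule T.subspaceI)
    show "0 \<in> f ` M" using S.subspace_0[OF assms(3)] assms(4) by (metis imageI)
    fix a b assume "a \<in> f ` M" "b \<in> f ` M"
    then show "a + b \<in> f ` M" using S.subspace_add[OF assms(3)] assms(5) by (metis (no_types) imageE imageI)
  next
    fix c a assume "a \<in> f ` M"
    then show "t c a \<in> f ` M" using S.subspace_scale[OF assms(3)] assms(6) by (metis (no_types) imageE imageI)
  qed
qed

lemma subspace_at_nil: "module s \<Longrightarrow> module.subspace s M \<Longrightarrow> module.subspace (pointwise s) (at_nil ` M)"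
  by (rule subspace_image[where f=at_nil and s=s]) (simp_all only: module_pointwise at_nil_0 at_nil_add at_nil_scale)
lemma subspace_prepend: "module s \<Longrightarrow> module.subspace (pointwise s) M \<Longrightarrow> module.subspace (pointwise s) (prepend x ` M)"
  by (rule subspace_image[where f="prepend x" and s="pointwise s"]) (simp_all only: module_pointwise prepend_0 prepend_add prepend_scale)

lemma subspace_minimal_component:
  assumes "module s" "finite (elts L)" "module.subspace s U\<^sub>0" "\<And>a. a\<in>elts L \<Longrightarrow> module.subspace s (U a)" "x \<in> elts L"
  shows "module.subspace (pointwise s) (minimal_component L U\<^sub>0 U i x)"
  using assms
proof (induction L U\<^sub>0 U i x rule: minimal_component.induct)
  case (1 L U\<^sub>0 U x)
  show ?case unfolding minimal_component.simps by (rule subspace_at_nil[OF 1(1) 1(3)])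
next
  case (2 L U\<^sub>0 U x)
  show ?case unfolding minimal_component.simps
    by (rule subspace_prepend[OF 2(1)], rule subspace_at_nil[OF 2(1)], rule 2(4), rule 2(5))
next
  case (3 L U\<^sub>0 U i x)
  interpret P: module "pointwise s :: _ \<Rightarrow> (_ list \<Rightarrow> _) \<Rightarrow> _" by (rule module_pointwise) fact
  have sb: "{y. covered_by L y x} \<subseteq> elts L" by (auto simp: covered_by_def)
  have *: "P.subspace (sum_sub (minimal_component L U\<^sub>0 U (Suc i)) {y. covered_by L y x})"
  proof (rule subspace_sum_sub[OF P.module_axioms finite_subset[OF sb 3(3)]])
    fix y assume "y \<in> {y. covered_by L y x}"
    then show "P.subspace (minimal_component L U\<^sub>0 U (Suc i) y)"
      using 3(1)[of y] 3(2-5) sb by blast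
  qed
  have z: "chain_diff L 0 = 0" by (simp add: chain_diff_def zero_fun_def)
  have "P.subspace {v \<in> sum_sub (minimal_component L U\<^sub>0 U (Suc i)) {y. covered_by L y x}. chain_diff L v = 0}"
  proof (rule P.subspaceI, goal_cases)
    case 1 then show ?case using P.subspace_0[OF *] z by blast
  next
    case (2 a b) then show ?case using P.subspace_add[OF *] by (simp add: linear_chain_diff(1) del: plus_fun_apply)
  next
    case (3 c a) then show ?case using P.subspace_scale[OF *] by (simp add: linear_chain_diff(2)[OF \<open>module s\<close>])
  qed
  then show ?case unfolding minimal_component.simps by (rule subspace_prepend[OF 3(2)])
qed

lemma sum_sub_mono: assumes "I \<subseteq> J" "finite J" "\<And>x. x \<in> I \<Longrightarrow> V x \<subseteq> W x" "\<And>x. x \<in> J \<Longrightarrow> 0 \<in> W x" 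
  shows "sum_sub V I \<subseteq> sum_sub W J"
  unfolding sum_sub_def
proof clarify
  fix v assume v: "\<forall>x\<in>I. v x \<in> V x"
  have "sum v I = sum (\<lambda>x. if x \<in> I then v x else 0) J" 
    using assms(1,2) by (auto intro!: sum.mono_neutral_cong_left)
  then show "\<exists>w. sum v I = sum w J \<and> (\<forall>x\<in>J. w x \<in> W x)"
    using v assms by (intro exI[of _ "\<lambda>x. if x \<in> I then v x else 0"]) auto
qed

lemma sum_sub_cong: "(\<And>x. x \<in> I \<Longrightarrow> V x = W x) \<Longrightarrow> sum_sub V I = sum_sub W I"
  unfolding sum_sub_def by (intro Collect_cong ex_cong1 conj_cong ball_cong) simp_all

lemma minimal_component_prependD: "x \<in> elts L \<Longrightarrow> w \<in> minimal_component L U\<^sub>0 U (Suc i) x \<Longrightarrow> \<exists>v. w = prepend x v"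
  by (cases i) auto

text \<open>
  Properties of the rank function that hold in every geometric lattice and suffice for the minimal
  complex to be compatibly graded.
\<close>

definition ranked_with_bottom :: "'l ranked_poset \<Rightarrow> bool" where
  "ranked_with_bottom L \<longleftrightarrow> finite (elts L) \<and>
     (\<forall>x\<in>elts L. \<forall>y\<in>elts L. rk L x = 0 \<and> rk L y = 0 \<longrightarrow> x = y) \<and>
     (\<forall>x\<in>elts L. rk L x = 1 \<longrightarrow> (\<exists>y. covered_by L y x)) \<and>
     (\<forall>x y. covered_by L y x \<longrightarrow> rk L x = Suc (rk L y))"

text \<open>
  The next two lemmas show that the chain encoding has the defining properties of the minimal
  complex: it is compatibly graded, \<open>\<partial>\<close> identifies \<open>W\<^sub>a\<close> with \<open>U\<^sub>a \<subseteq> U\<^sub>0\<close>, and for \<open>rk x = i > 1\<close> it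
  identifies \<open>W\<^sub>x\<close> with the kernel of \<open>\<partial>\<^bsub>i-1\<^esub>\<close> on \<open>\<Oplus>\<^bsub>y \<prec> x\<^esub> W\<^sub>y\<close>. (\<open>W\<^sub>0 = U\<^sub>0\<close> holds by definition.)
\<close>

lemma minimal_complex_differential:
  assumes L: "ranked_with_bottom L"
  shows "x \<in> elts L \<Longrightarrow> rk L x = 1 \<Longrightarrow>
     bij_betw (diff (minimal_complex L U\<^sub>0 U) 1) (component (minimal_complex L U\<^sub>0 U) x) (at_nil ` U x)"
    and "x \<in> elts L \<Longrightarrow> rk L x > 1 \<Longrightarrow>
     bij_betw (diff (minimal_complex L U\<^sub>0 U) (rk L x)) (component (minimal_complex L U\<^sub>0 U) x)
       {v \<in> sum_sub (component (minimal_complex L U\<^sub>0 U)) {y. covered_by L y x}. diff (minimal_complex L U\<^sub>0 U) (rk L x - 1) v = 0}"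
proof -
  have fin: "finite (elts L)" using L by (auto simp: ranked_with_bottom_def)
  have b: "bij_betw (chain_diff L) (prepend x ` A) A" if "x \<in> elts L" for A and x
    by (rule bij_betw_byWitness[where f'="prepend x"]) (auto simp only: chain_diff_prepend[OF fin that] image_iff)
  { assume "x \<in> elts L" "rk L x = 1"
    then show "bij_betw (diff (minimal_complex L U\<^sub>0 U) 1) (component (minimal_complex L U\<^sub>0 U) x) (at_nil ` U x)"
      unfolding minimal_complex_def using b by simp }
  { assume x: "x \<in> elts L" and r: "rk L x > 1"
    then obtain i where i: "rk L x = Suc (Suc i)" using that[of "rk L x - 2"] by simp
    have cov: "covered_by L y x \<Longrightarrow> rk L y = Suc i" for y 
    proof -
      assume "covered_by L y x"
      then have "rk L x = Suc (rk L y)" using L unfolding ranked_with_bottom_def by blast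
      then show ?thesis using i by simp
    qed
    have "sum_sub (component (minimal_complex L U\<^sub>0 U)) {y. covered_by L y x} = 
       sum_sub (minimal_component L U\<^sub>0 U (Suc i)) {y. covered_by L y x}"
      by (rule sum_sub_cong) (simp add: minimal_complex_def cov)
    then have e: "sum_sub (component (minimal_complex L U\<^sub>0 U)) {y. covered_by L y x} = 
       sum_sub (minimal_component L U\<^sub>0 U (Suc i)) {y. covered_by L y x}" .
    have d: "diff (minimal_complex L U\<^sub>0 U) j = chain_diff L" for j by (simp add: minimal_complex_def)
    have c: "component (minimal_complex L U\<^sub>0 U) x = prepend x ` {v \<in> sum_sub (minimal_component L U\<^sub>0 U (Suc i)) {y. covered_by L y x}. chain_diff L v = 0}"
      by (simp add: minimal_complex_def i)
    show "bij_betw (diff (minimal_complex L U\<^sub>0 U) (rk L x)) (component (minimal_complex L U\<^sub>0 U) x)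
       {v \<in> sum_sub (component (minimal_complex L U\<^sub>0 U)) {y. covered_by L y x}. diff (minimal_complex L U\<^sub>0 U) (rk L x - 1) v = 0}"
      unfolding e d c by (rule b[OF x]) }
qed

lemma minimal_complex_compatibly_graded:
  assumes "module s" and L: "ranked_with_bottom L"
    and U: "module.subspace s U\<^sub>0" "\<And>a. a\<in>elts L \<Longrightarrow> module.subspace s (U a)" "\<And>a. a\<in>elts L \<Longrightarrow> rk L a = 1 \<Longrightarrow> U a \<subseteq> U\<^sub>0"
  shows "compatibly_graded (pointwise s) L (minimal_complex L U\<^sub>0 U)" (is "compatibly_graded _ _ ?W")
proof -
  have fin: "finite (elts L)" using L by (auto simp: ranked_with_bottom_def)
  have fc: "finite {y. covered_by L y x}" for x by (rule finite_subset[OF _ fin]) (auto simp: covered_by_def)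
  have fr: "finite {y\<in>elts L. rk L y = i}" for i using fin by simp
  interpret P: module "pointwise s :: _ \<Rightarrow> (_ list \<Rightarrow> _) \<Rightarrow> _" by (rule module_pointwise) fact
  have sub: "P.subspace (component ?W x)" if "x \<in> elts L" for x
    unfolding minimal_complex_def using subspace_minimal_component[OF assms(1) fin U(1,2) that] by simp
  have z: "chain_diff L 0 = 0" by (auto simp: chain_diff_def zero_fun_def)
  have cov: "y \<in> elts L \<and> rk L x = Suc (rk L y)" if "covered_by L y x" for x y
  proof
    show "y \<in> elts L" using that by (simp add: covered_by_def)
    show "rk L x = Suc (rk L y)" using L that unfolding ranked_with_bottom_def by blast
  qed
  have uniq: "a = b" if "a \<in> elts L" "b \<in> elts L" "rk L a = 0" "rk L b = 0" for a b
    using L that unfolding ranked_with_bottom_def by blast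
  have to_cov: "diff ?W (rk L x) w \<in> sum_sub (component ?W) {y. covered_by L y x}" 
    if x: "x \<in> elts L" and r: "rk L x \<noteq> 0" and w: "w \<in> component ?W x" for x w
  proof (cases "rk L x = 1")
    case True
    from True x L obtain y where y: "covered_by L y x" unfolding ranked_with_bottom_def by blast
    then have ry: "rk L y = 0" using cov[OF y] True by simp
    have "y' = y" if "covered_by L y' x" for y'
    proof -
      have "rk L y' = 0" using cov[OF that] True by simp
      then show ?thesis using L ry cov[OF y] cov[OF that] unfolding ranked_with_bottom_def by blast
    qed
    then have "{y. covered_by L y x} = {y}" using y by blast
    moreover have "diff ?W (rk L x) w \<in> at_nil ` U x" 
      using bij_betwE[OF minimal_complex_differential(1)[OF L x True]] w True by auto
    moreover have "component ?W y = at_nil ` U\<^sub>0" using ry by (simp add: minimal_complex_def)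
    ultimately have c: "{y. covered_by L y x} = {y}" "diff ?W (rk L x) w \<in> component ?W y" using U(3)[OF x True] by auto
    show ?thesis unfolding c(1) sum_sub_def using c(2) by (auto intro!: exI[of _ "\<lambda>_. diff ?W (rk L x) w"])
  next
    case False
    then show ?thesis using bij_betwE[OF minimal_complex_differential(2)[OF L x, of U\<^sub>0 U]] w r by auto
  qed
  have to_deg: "chain_diff L v \<in> chain_module L ?W (i - 1)" if "i \<ge> 1" "v \<in> chain_module L ?W i" for i v
  proof -
    from that obtain w where w: "v = sum w {x\<in>elts L. rk L x = i}" "\<And>x. x\<in>elts L \<Longrightarrow> rk L x = i \<Longrightarrow> w x \<in> component ?W x"
      unfolding chain_module_def sum_sub_def by blast
    have "chain_diff L (w x) \<in> chain_module L ?W (i - 1)" if x: "x \<in> elts L" "rk L x = i" for x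
    proof -
      have "chain_diff L (w x) \<in> sum_sub (component ?W) {y. covered_by L y x}"
        using to_cov[OF x(1) _ w(2)[OF x]] x \<open>i \<ge> 1\<close> by (simp add: minimal_complex_def)
      moreover have "{y. covered_by L y x} \<subseteq> {x \<in> elts L. rk L x = i - 1}"
        using cov x by fastforce
      then have "sum_sub (component ?W) {y. covered_by L y x} \<subseteq> chain_module L ?W (i - 1)"
        unfolding chain_module_def by (rule sum_sub_mono[OF _ fr order_refl]) (use P.subspace_0[OF sub] in auto)
      ultimately show ?thesis by blast
    qed
    moreover have "P.subspace (chain_module L ?W (i - 1))" unfolding chain_module_def
      by (rule subspace_sum_sub) (use P.module_axioms fr sub in auto)
    ultimately show ?thesis unfolding w(1) chain_diff_sum by (intro P.subspace_sum) blast+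
  qed
  have dd: "chain_diff L (chain_diff L v) = 0" if "i \<ge> 1" "v \<in> chain_module L ?W (i + 1)" for i v
  proof -
    from that obtain w where w: "v = sum w {x\<in>elts L. rk L x = i+1}" "\<And>x. x\<in>elts L \<Longrightarrow> rk L x = i+1 \<Longrightarrow> w x \<in> component ?W x"
      unfolding chain_module_def sum_sub_def by blast
    have "chain_diff L (chain_diff L (w x)) = 0" if x: "x \<in> elts L" "rk L x = i+1" for x
    proof -
      have "diff ?W (rk L x) (w x) \<in> {v \<in> sum_sub (component ?W) {y. covered_by L y x}. diff ?W (rk L x - 1) v = 0}"
        using bij_betwE[OF minimal_complex_differential(2)[OF L x(1), of U\<^sub>0 U]] w(2)[OF x] x(2) \<open>i\<ge>1\<close> by simp
      then show ?thesis by (simp add: minimal_complex_def)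
    qed
    then show ?thesis unfolding w(1) chain_diff_sum by (intro sum.neutral) blast
  qed
  have dir: "direct_sub (component ?W) {x\<in>elts L. rk L x = i}" for i
    unfolding direct_sub_def
  proof (intro allI impI ballI, elim conjE)
    fix v x assume v: "\<forall>x\<in>{x \<in> elts L. rk L x = i}. v x \<in> component ?W x" and s0: "sum v {x \<in> elts L. rk L x = i} = 0"
      and x: "x \<in> {x \<in> elts L. rk L x = i}"
    show "v x = 0"
    proof (cases i)
      case 0
      have "y = x" if "y \<in> elts L" "rk L y = i" for y
        by (rule uniq) (use x that 0 in simp_all)
      then have "{x \<in> elts L. rk L x = i} = {x}" using x by blast
      then show ?thesis using s0 by simp
    next
      case (Suc j)
      have pre: "\<exists>u. v y = prepend y u" if "y \<in> elts L" "rk L y = i" for y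
        proof -
        have "v y \<in> minimal_component L U\<^sub>0 U (Suc j) y" using v that Suc by (simp add: minimal_complex_def)
        then show ?thesis by (rule minimal_component_prependD[OF that(1)])
      qed
      show ?thesis
      proof
        fix c
        show "v x c = 0 c"
        proof (cases c)
          case Nil
          obtain u where "v x = prepend x u" using pre[of x] x by blast
          then show ?thesis using Nil by (simp add: prepend_def)
        next
          case (Cons h t)
          have app: "(sum v A) c = (\<Sum>y\<in>A. v y c)" for A by (induction A rule: infinite_finite_induct) simp_all
          have zer: "v y c = 0" if yh: "y \<in> elts L" "rk L y = i" "y \<noteq> h" for y
            proof -
            obtain u where "v y = prepend y u" using pre[OF yh(1,2)] by blast
            then show ?thesis using yh(3) Cons by (simp add: prepend_def)
          qed
          show ?thesis
          proof (cases "h = x")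
            case True
            have "0 = (\<Sum>y\<in>{x \<in> elts L. rk L x = i}. v y c)" using s0 app[of "{x \<in> elts L. rk L x = i}"] by simp
            also have "\<dots> = (\<Sum>y\<in>{x}. v y c)" by (rule sum.mono_neutral_right[OF fr]) (use x zer True in blast)+
            finally show ?thesis by simp
          next
            case False then have "v x c = 0" using zer[of x] x by blast then show ?thesis by simp
          qed
        qed
      qed
    qed
  qed
  show ?thesis unfolding compatibly_graded_def
  proof (intro conjI allI ballI impI)
    fix i :: nat assume "1 \<le> i"
    then show "linear_between (pointwise s) (chain_module L ?W i) (chain_module L ?W (i - 1)) (diff ?W i)"
      unfolding linear_between_def
      using to_deg[of i] 
      by (simp add: minimal_complex_def linear_chain_diff(1) linear_chain_diff(2)[OF assms(1)] del: plus_fun_apply)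
  next
    fix i :: nat and v assume "1 \<le> i" "v \<in> chain_module L ?W (i + 1)"
    then show "diff ?W i (diff ?W (i + 1) v) = 0" using dd[of i v] by (simp add: minimal_complex_def)
  next
    fix x assume "x \<in> elts L" "rk L x \<noteq> 0"
    then show "diff ?W (rk L x) ` component ?W x \<subseteq> sum_sub (component ?W) {y. covered_by L y x}"
      using to_cov by blast
  qed (fact sub dir)+
qed


section \<open>Hyperplane arrangements in the dual space\<close>

definition dual_space :: "('k::field \<Rightarrow> 'u::ab_group_add \<Rightarrow> 'u) \<Rightarrow> ('u \<Rightarrow> 'k) set" where
  "dual_space s = {f. Vector_Spaces.linear s (*) f}"

abbreviation dual_dim :: "('u \<Rightarrow> 'k::field) set \<Rightarrow> nat" where
  "dual_dim \<equiv> vector_space.dim (pointwise (*) :: 'k \<Rightarrow> ('u \<Rightarrow> 'k) \<Rightarrow> ('u \<Rightarrow> 'k))"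

definition codim :: "('k::field \<Rightarrow> 'u::ab_group_add \<Rightarrow> 'u) \<Rightarrow> ('u \<Rightarrow> 'k) set \<Rightarrow> nat" where
  "codim s X = dual_dim (dual_space s) - dual_dim X"

definition is_hyperplane ::
    "('k::field \<Rightarrow> 'u::ab_group_add \<Rightarrow> 'u) \<Rightarrow> ('u \<Rightarrow> 'k) set \<Rightarrow> bool" where
  "is_hyperplane s H \<longleftrightarrow>
     H \<subseteq> dual_space s \<and> module.subspace (pointwise (*)) H \<and> codim s H = 1"

definition arrangement ::
    "('k::field \<Rightarrow> 'u::ab_group_add \<Rightarrow> 'u) \<Rightarrow> ('u \<Rightarrow> 'k) set set \<Rightarrow> bool" where
  "arrangement s \<H> \<longleftrightarrow> finite \<H> \<and> (\<forall>H\<in>\<H>. is_hyperplane s H)"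

definition intersection_lattice ::
    "('k::field \<Rightarrow> 'u::ab_group_add \<Rightarrow> 'u) \<Rightarrow> ('u \<Rightarrow> 'k) set set \<Rightarrow>
     ('u \<Rightarrow> 'k) set ranked_poset" where
  "intersection_lattice s \<H> =
     \<lparr>elts = {dual_space s \<inter> \<Inter>\<A> | \<A>. \<A> \<subseteq> \<H>}, leq = (\<lambda>y x. x \<subseteq> y), rk = codim s\<rparr>"

text \<open>
  The minimal complex evaluates the family of submodules only at the flats of rank 1, which are
  the hyperplanes of the arrangement.
\<close>

definition perp :: "('u \<Rightarrow> 'k::zero) set \<Rightarrow> 'u set" where
  "perp H = {u. \<forall>f\<in>H. f u = 0}"

definition relation_complex ::
    "('k::field \<Rightarrow> 'u::ab_group_add \<Rightarrow> 'u) \<Rightarrow> ('u \<Rightarrow> 'k) set set \<Rightarrow>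
     (('u \<Rightarrow> 'k) set, ('u \<Rightarrow> 'k) set list \<Rightarrow> 'u) graded_complex" where
  "relation_complex s \<H> = minimal_complex (intersection_lattice s \<H>) UNIV perp"


section \<open>The symmetric algebra\<close>

text \<open>
  \<open>Sym U\<close> is the quotient of the polynomial ring \<open>K[X\<^sub>u | u \<in> U]\<close> by the ideal generated by
  the elements \<open>X\<^bsub>u+v\<^esub> - X\<^sub>u - X\<^sub>v\<close> and \<open>X\<^bsub>cu\<^esub> - c X\<^sub>u\<close>. A type cannot depend on the scalar
  multiplication of \<open>U\<close>, so this is expressed as a property of a commutative ring with structure map
  \<open>\<kappa>\<close> from \<open>K\<close> and a map \<open>\<iota>\<close> from \<open>U\<close>: the \<open>K\<close>-algebra homomorphism \<open>X\<^sub>u \<mapsto> \<iota> u\<close> is onto and its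
  kernel is that ideal.
\<close>

type_synonym ('u, 'k) mpoly = "('u \<Rightarrow>\<^sub>0 nat) \<Rightarrow>\<^sub>0 'k"

definition const :: "'k \<Rightarrow> ('u, 'k::comm_ring_1) mpoly" where
  "const c = Poly_Mapping.single 0 c"

definition var :: "'u \<Rightarrow> ('u, 'k::comm_ring_1) mpoly" where
  "var u = Poly_Mapping.single (Poly_Mapping.single u 1) 1"

definition eval_mpoly ::
    "('k \<Rightarrow> 's) \<Rightarrow> ('u \<Rightarrow> 's) \<Rightarrow> ('u, 'k::comm_ring_1) mpoly \<Rightarrow> 's::comm_ring_1" where
  "eval_mpoly \<kappa> \<iota> p =
     (\<Sum>m\<in>Poly_Mapping.keys p. \<kappa> (Poly_Mapping.lookup p m) *
        (\<Prod>u\<in>Poly_Mapping.keys m. \<iota> u ^ Poly_Mapping.lookup m u))"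

definition ideal_gen :: "'a::comm_ring_1 set \<Rightarrow> 'a set" where
  "ideal_gen A = module.span (*) A"

definition linear_relations ::
    "('k::comm_ring_1 \<Rightarrow> 'u::ab_group_add \<Rightarrow> 'u) \<Rightarrow> ('u, 'k) mpoly set" where
  "linear_relations s =
     {var (u + v) - var u - var v | u v. True} \<union> {var (s c u) - const c * var u | c u. True}"

definition is_ring_hom :: "('a::comm_ring_1 \<Rightarrow> 'b::comm_ring_1) \<Rightarrow> bool" where
  "is_ring_hom f \<longleftrightarrow>
     f 1 = 1 \<and> (\<forall>a b. f (a + b) = f a + f b) \<and> (\<forall>a b. f (a * b) = f a * f b)"

definition is_symmetric_algebra ::
    "('k::comm_ring_1 \<Rightarrow> 'u::ab_group_add \<Rightarrow> 'u) \<Rightarrow> ('k \<Rightarrow> 's::comm_ring_1) \<Rightarrow> ('u \<Rightarrow> 's) \<Rightarrow> bool" where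
  "is_symmetric_algebra s \<kappa> \<iota> \<longleftrightarrow>
     is_ring_hom \<kappa> \<and> surj (eval_mpoly \<kappa> \<iota>) \<and>
     {p. eval_mpoly \<kappa> \<iota> p = 0} = ideal_gen (linear_relations s)"

end

theory Submission
  imports Defs
begin

text \<open>
  An \<open>L\<close>-homotopy for the relation complex provides, through its first two maps, linear maps
  \<open>\<delta>\<^sub>a : U \<rightarrow> a\<^sup>\<bottom>\<close> indexed by the atoms whose sum is a projection \<open>T\<close> onto the span of the
  lines \<open>a\<^sup>\<bottom>\<close>, and such that \<open>\<Sum>\<delta>\<^sub>z\<close>, over the atoms \<open>z \<noteq> a\<close> below a rank two flat above \<open>a\<close>,
  preserves \<open>a\<^sup>\<bottom>\<close>. Extend \<open>\<delta>\<^sub>a\<close> to a derivation \<open>\<theta>\<^sub>a\<close> of \<open>Sym U\<close>, and let \<open>E = \<Sum>\<theta>\<^sub>a\<close>, a partial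
  Euler operator. In a geometric lattice, the map \<open>f \<mapsto> (\<theta>\<^sub>a f)\<^sub>a\<close> extends to a map \<open>D\<close> of degree one on
  the minimal complex \<open>W\<close> with \<open>\<partial>D + D\<partial> = E\<close>: for \<open>w \<in> W\<^sub>x\<close>, the cycle \<open>E w - D \<partial>w\<close> splits into
  cycles supported below the individual covers \<open>t\<close> of \<open>x\<close>. The elements of the ideals are sums of
  eigenvectors of \<open>E\<close> with positive integral eigenvalues, so in characteristic zero \<open>E\<close> is invertible
  on the cycles of \<open>W\<close> in positive degree, and every such cycle is a boundary.
\<close>

section \<open>Splitting chains along covers\<close>

text \<open>The part of a chain at \<open>x\<close> with its leading \<open>x\<close> removed, that
  is, the boundary of its \<open>x\<close>-component.\<close>

definition tail :: "'l \<Rightarrow> ('l list \<Rightarrow> 'm) \<Rightarrow> 'l list \<Rightarrow> 'm" where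
  "tail x w = (\<lambda>c. w (x # c))"

lemma tail_apply: "tail x w c = w (x # c)"
  by (simp add: tail_def)

lemma tail_simps [simp]:
  "tail x 0 = 0" "tail x (v + w) = tail x v + tail x w"
  "tail x (v' - w') = tail x v' - tail x w'" "tail x (- v') = - tail x v'"
  by (simp_all add: fun_eq_iff tail_apply)

lemma sum_fun_apply: "(\<Sum>i\<in>I. f i) c = (\<Sum>i\<in>I. f i c)"
  by (induction I rule: infinite_finite_induct) simp_all

lemma tail_sum [simp]: "tail x (\<Sum>i\<in>I. f i) = (\<Sum>i\<in>I. tail x (f i))"
  by (simp add: fun_eq_iff sum_fun_apply tail_apply)

lemma prepend_Nil [simp]: "prepend x v [] = 0"
  by (simp add: prepend_def)

lemma tail_prepend [simp]: "tail x (prepend y v) = (if x = y then v else 0)"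
  by (auto simp: prepend_def fun_eq_iff tail_apply)

lemma at_nil_Nil [simp]: "at_nil f [] = f"
  by (simp add: at_nil_def)

lemma fun_list_eqI: "u [] = v [] \<Longrightarrow> (\<And>x. tail x u = tail x v) \<Longrightarrow> u = v"
  by (rule ext, case_tac x) (simp, metis tail_apply)

lemma chain_diff_tail: "chain_diff L w = (\<Sum>x\<in>elts L. tail x w)"
  by (simp add: chain_diff_def fun_eq_iff sum_fun_apply tail_apply)

text \<open>The copies \<open>prepend x\<close> for different \<open>x\<close> have disjoint
  supports, so a sum of such copies is determined by its tails. Membership thereby becomes a
  componentwise condition, with no decomposition to choose.\<close>

lemma sum_sub_prepend_iff:
  fixes u :: "'l list \<Rightarrow> 'm::comm_monoid_add"
  assumes "finite A"
  shows "u \<in> sum_sub (\<lambda>x. prepend x ` Z x) A \<longleftrightarrow>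
    u [] = 0 \<and> (\<forall>x\<in>A. tail x u \<in> Z x) \<and> (\<forall>x. x \<notin> A \<longrightarrow> tail x u = 0)"
proof
  assume "u \<in> sum_sub (\<lambda>x. prepend x ` Z x) A"
  then obtain v where v: "u = sum v A" "\<And>x. x \<in> A \<Longrightarrow> v x \<in> prepend x ` Z x"
    unfolding sum_sub_def by blast
  define z where "z x = tail x (v x)" for x
  have z: "v x = prepend x (z x) \<and> z x \<in> Z x" if "x \<in> A" for x
    using v(2)[OF that] by (auto simp: z_def)
  have u: "u = (\<Sum>x\<in>A. prepend x (z x))" using v(1) z by simp
  have "tail y u = (if y \<in> A then z y else 0)" for y
    unfolding u using assms by (simp add: sum.delta)
  moreover have "u [] = 0" unfolding u by (simp add: sum_fun_apply)
  ultimately show "u [] = 0 \<and> (\<forall>x\<in>A. tail x u \<in> Z x) \<and> (\<forall>x. x \<notin> A \<longrightarrow> tail x u = 0)"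
    using z by simp
next
  assume *: "u [] = 0 \<and> (\<forall>x\<in>A. tail x u \<in> Z x) \<and> (\<forall>x. x \<notin> A \<longrightarrow> tail x u = 0)"
  have "u = (\<Sum>x\<in>A. prepend x (tail x u))"
    by (rule fun_list_eqI) (use * assms in \<open>simp_all add: sum_fun_apply sum.delta\<close>)
  then show "u \<in> sum_sub (\<lambda>x. prepend x ` Z x) A"
    using * unfolding sum_sub_def by blast
qed

text \<open>This is the component of the minimal complex at \<open>x\<close> without its leading
  \<open>x\<close>, or equivalently its image under the differential. The index is one less than the
  rank of \<open>x\<close>.\<close>

fun cycles :: "'l ranked_poset \<Rightarrow> ('l \<Rightarrow> 'm::comm_monoid_add set) \<Rightarrow> nat \<Rightarrow> 'l \<Rightarrow>
    ('l list \<Rightarrow> 'm) set" where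
  "cycles L U 0 x = at_nil ` U x"
| "cycles L U (Suc i) x =
     {v \<in> sum_sub (\<lambda>y. prepend y ` cycles L U i y) {y. covered_by L y x}. chain_diff L v = 0}"

lemma minimal_component_Suc: "minimal_component L U\<^sub>0 U (Suc i) x = prepend x ` cycles L U i x"
proof (induction i arbitrary: x)
  case (Suc i)
  then have "minimal_component L U\<^sub>0 U (Suc i) = (\<lambda>y. prepend y ` cycles L U i y)" by blast
  then show ?case by simp
qed simp

lemma chain_module_minimal_complex:
  "chain_module L (minimal_complex L U\<^sub>0 U) (Suc i) =
     sum_sub (\<lambda>x. prepend x ` cycles L U i x) {x \<in> elts L. rk L x = Suc i}"
  unfolding chain_module_def minimal_complex_def
  by (rule sum_sub_cong) (simp add: minimal_component_Suc)

text \<open>Joins are replaced by statements about covers: \<open>semimodular\<close> supplies a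
  common cover, and \<open>cover_unique\<close> expresses that a cover of \<open>x\<close> above
  some \<open>y\<close> not below \<open>x\<close> can only be the join of \<open>x\<close> and
  \<open>y\<close>.\<close>

locale geometric_poset =
  fixes L :: "'l ranked_poset"
  assumes ranked: "ranked_with_bottom L"
    and leq_trans: "\<lbrakk>x \<in> elts L; y \<in> elts L; z \<in> elts L; leq L x y; leq L y z\<rbrakk> \<Longrightarrow> leq L x z"
    and leq_same_rank: "\<lbrakk>x \<in> elts L; y \<in> elts L; leq L x y; rk L x = rk L y\<rbrakk> \<Longrightarrow> x = y"
    and leq_covered: "\<lbrakk>y \<in> elts L; x \<in> elts L; leq L y x; rk L x = Suc (rk L y)\<rbrakk> \<Longrightarrow> covered_by L y x"
    and semimodular: "\<lbrakk>covered_by L y x; covered_by L y z; x \<noteq> z\<rbrakk> \<Longrightarrow>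
      \<exists>t. covered_by L x t \<and> covered_by L z t"
    and cover_unique: "\<lbrakk>covered_by L x t; covered_by L x t'; y \<in> elts L; leq L y t; leq L y t';
      \<not> leq L y x\<rbrakk> \<Longrightarrow> t = t'"
begin

section \<open>Combinatorics of covers\<close>

abbreviation cov (infix "\<prec>" 50) where "y \<prec> x \<equiv> covered_by L y x"

lemma covD: assumes "y \<prec> x" shows "y \<in> elts L" "x \<in> elts L" "leq L y x"
  using assms by (auto simp: covered_by_def)

lemma finite_elts: "finite (elts L)"
  and rank_covered: "y \<prec> x \<Longrightarrow> rk L x = Suc (rk L y)"
  using ranked by (auto simp: ranked_with_bottom_def)

lemma atoms_covered:
  assumes "x \<in> elts L" "z \<in> elts L" "rk L x = 1" "rk L z = 1"
  shows "\<exists>y. y \<prec> x \<and> y \<prec> z"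
proof -
  obtain y y' where y: "y \<prec> x" "y' \<prec> z"
    using ranked assms unfolding ranked_with_bottom_def by blast
  then have "rk L y = 0" "rk L y' = 0" using rank_covered assms by fastforce+
  then have "y = y'" using ranked covD(1) y unfolding ranked_with_bottom_def by blast
  then show ?thesis using y by blast
qed

lemma finite_cov [simp]: "finite {y. y \<prec> x}" "finite {y. y \<prec> x \<and> P y}" "finite {t. x \<prec> t}"
  "finite {t. x \<prec> t \<and> P t}" "finite {x \<in> elts L. P x}"
  by (rule finite_subset[OF _ finite_elts]; auto simp: covered_by_def)+

lemma chain_diff_supported:
  assumes "\<And>x. x \<in> elts L - A \<Longrightarrow> tail x u = 0" "A \<subseteq> elts L"
  shows "chain_diff L u = (\<Sum>x\<in>A. tail x u)"
  unfolding chain_diff_tail by (rule sum.mono_neutral_right) (use assms finite_elts in auto)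

lemma cycles_Suc_iff:
  "v \<in> cycles L U (Suc i) x \<longleftrightarrow> v [] = 0 \<and> (\<forall>y. y \<prec> x \<longrightarrow> tail y v \<in> cycles L U i y) \<and>
     (\<forall>y. \<not> y \<prec> x \<longrightarrow> tail y v = 0) \<and> chain_diff L v = 0"
  by (simp add: sum_sub_prepend_iff)

lemma chain_diff_0 [simp]: "chain_diff L 0 = 0"
  by (simp add: chain_diff_tail)

text \<open>Semimodularity gives existence. For uniqueness, \<open>z\<close> is not below
  \<open>x\<close> because both have the same rank, so \<open>cover_unique\<close> applies with
  \<open>z\<close> as the extra element.\<close>

lemma common_cover_ex1:
  assumes "y \<prec> x" "y \<prec> z" "x \<noteq> z" shows "\<exists>!t. x \<prec> t \<and> z \<prec> t"
proof -
  have "\<not> leq L z x"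
    using leq_same_rank[of z x] assms covD rank_covered by metis
  then show ?thesis
    using semimodular[OF assms] cover_unique[of x _ _ z] covD by metis
qed

text \<open>Both \<open>t\<close> and the common cover of \<open>x\<close> and \<open>z\<close> are
  covers of \<open>x\<close> lying above \<open>y\<close>. Since \<open>y\<close> is not below
  \<open>x\<close>, they coincide.\<close>

lemma cov_transfer:
  assumes "y' \<prec> x" "y' \<prec> z" "y \<prec> z" "\<not> y \<prec> x" "y \<prec> z'" "z' \<prec> t" "x \<prec> t"
  shows "z \<prec> t"
proof -
  have "x \<noteq> z" using assms by blast
  then obtain t' where t': "x \<prec> t'" "z \<prec> t'" using semimodular assms by blast
  have nle: "\<not> leq L y x"
    using leq_covered[of y x] assms covD rank_covered by (metis nat.inject)
  have "leq L y t" "leq L y t'" using leq_trans assms t' covD by metis+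
  then have "t = t'" using cover_unique[OF assms(7) t'(1)] nle assms covD by blast
  then show ?thesis using t' by simp
qed

text \<open>
  If the components of \<open>u\<close> lie at elements sharing a lower cover with \<open>x\<close>, then each component
  at some \<open>z \<noteq> x\<close> belongs to exactly one cover \<open>t = x \<or> z\<close> of \<open>x\<close>. This decomposes \<open>u\<close>, up to
  its component at \<open>x\<close>, into the chains \<open>part x t u\<close>; subtracting one from an element of \<open>W\<^sub>x\<close> with
  the same boundary makes it a cycle, \<open>fill x t u\<close>, hence an element of \<open>W\<^sub>t\<close>.
\<close>

definition part :: "'l \<Rightarrow> 'l \<Rightarrow> ('l list \<Rightarrow> 'm) \<Rightarrow> 'l list \<Rightarrow> 'm::ab_group_add" where
  "part x t u = (\<Sum>z | z \<prec> t \<and> z \<noteq> x. prepend z (tail z u))"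

definition fill :: "'l \<Rightarrow> 'l \<Rightarrow> ('l list \<Rightarrow> 'm) \<Rightarrow> 'l list \<Rightarrow> 'm::ab_group_add" where
  "fill x t u = prepend x (chain_diff L (part x t u)) - part x t u"

definition lift :: "'l \<Rightarrow> ('l list \<Rightarrow> 'm) \<Rightarrow> 'l list \<Rightarrow> 'm::ab_group_add" where
  "lift x u = (\<Sum>t | x \<prec> t. prepend t (fill x t u))"

lemma part_Nil [simp]: "part x t u [] = 0"
  by (simp add: part_def sum_fun_apply)

lemma tail_part: "tail z (part x t u) = (if z \<prec> t \<and> z \<noteq> x then tail z u else 0)"
  by (simp add: part_def sum.delta)

lemma chain_diff_part: "chain_diff L (part x t u) = (\<Sum>z | z \<prec> t \<and> z \<noteq> x. tail z u)"
  by (subst chain_diff_supported[where A = "{z. z \<prec> t \<and> z \<noteq> x}"])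
    (auto simp: tail_part covD)

lemma tail_lift: "tail t (lift x u) = (if x \<prec> t then fill x t u else 0)"
  by (simp add: lift_def sum.delta)

lemma lift_Nil [simp]: "lift x u [] = 0"
  by (simp add: lift_def sum_fun_apply)

lemma part_add: "part x t (u + v) = part x t u + part x t v"
  unfolding part_def tail_simps prepend_add by (rule sum.distrib)

lemma lift_add: "lift x (u + v) = lift x u + lift x v"
proof -
  have "fill x t (u + v) = fill x t u + fill x t v" for t
    unfolding fill_def part_add linear_chain_diff(1) prepend_add by (simp only: add_diff_add)
  then show ?thesis unfolding lift_def by (simp only: prepend_add sum.distrib)
qed

text \<open>Each \<open>z \<noteq> x\<close> in the support of \<open>u\<close> lies below exactly
  one cover of \<open>x\<close>, so the parts add up to \<open>u\<close> minus its component at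
  \<open>x\<close>. In the sum of the fills that component occurs twice with opposite signs and
  cancels.\<close>

lemma chain_diff_lift:
  assumes u: "u [] = 0" "\<And>z. tail z u \<noteq> 0 \<Longrightarrow> \<exists>y. y \<prec> x \<and> y \<prec> z"
    and x: "x \<in> elts L"
  shows "chain_diff L (lift x u) = prepend x (chain_diff L u) - u"
proof -
  \<comment> \<open>Double counting: whenever \<open>g z\<close> is nonzero,
    \<open>common_cover_ex1\<close> leaves exactly one \<open>t\<close> for which \<open>z\<close>
    occurs in the inner sum.\<close>
  have swap: "(\<Sum>t | x \<prec> t. \<Sum>z | z \<prec> t \<and> z \<noteq> x. g z) = (\<Sum>z\<in>elts L - {x}. g z)"
    if g: "\<And>z. g z \<noteq> 0 \<Longrightarrow> \<exists>y. y \<prec> x \<and> y \<prec> z" for g :: "'l \<Rightarrow> 'b::comm_monoid_add"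
  proof -
    have "(\<Sum>t | x \<prec> t. \<Sum>z | z \<prec> t \<and> z \<noteq> x. g z) =
        (\<Sum>t | x \<prec> t. \<Sum>z\<in>elts L - {x}. if z \<prec> t then g z else 0)"
      by (intro sum.cong refl sum.mono_neutral_cong_left) (auto simp: finite_elts covD)
    also have "\<dots> = (\<Sum>z\<in>elts L - {x}. \<Sum>t | x \<prec> t. if z \<prec> t then g z else 0)"
      by (rule sum.swap)
    also have "\<dots> = (\<Sum>z\<in>elts L - {x}. g z)"
    proof (rule sum.cong[OF refl])
      fix z assume z: "z \<in> elts L - {x}"
      show "(\<Sum>t | x \<prec> t. if z \<prec> t then g z else 0) = g z"
      proof (cases "g z = 0")
        case True
        then show ?thesis by (simp cong: if_cong)
      next
        case False
        then obtain y where "y \<prec> x" "y \<prec> z" using g by blast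
        then obtain t where t: "x \<prec> t" "z \<prec> t" "\<And>t'. x \<prec> t' \<Longrightarrow> z \<prec> t' \<Longrightarrow> t' = t"
          using common_cover_ex1[of y x z] z by blast
        then have "{t' \<in> {t. x \<prec> t}. z \<prec> t'} = {t}" by blast
        then show ?thesis by (simp add: sum.inter_filter[symmetric])
      qed
    qed
    finally show ?thesis .
  qed
  have supp: "tail z u = 0" if "z \<notin> elts L" for z
    using u(2)[of z] that covD by blast
  have "(\<Sum>t | x \<prec> t. part x t u) = (\<Sum>z\<in>elts L - {x}. prepend z (tail z u))"
    unfolding part_def by (rule swap) (metis prepend_0 u(2))
  also have "\<dots> = u - prepend x (tail x u)"
    by (rule fun_list_eqI)
      (use u(1) supp finite_elts in \<open>auto simp: sum_fun_apply sum.delta\<close>)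
  finally have parts: "(\<Sum>t | x \<prec> t. part x t u) = u - prepend x (tail x u)" .
  have "(\<Sum>t | x \<prec> t. chain_diff L (part x t u)) = (\<Sum>z\<in>elts L - {x}. tail z u)"
    unfolding chain_diff_part by (rule swap) (use u(2) in blast)
  also have "\<dots> = chain_diff L u - tail x u"
    unfolding chain_diff_tail using x finite_elts by (simp add: sum_diff1)
  finally have diffs: "(\<Sum>t | x \<prec> t. chain_diff L (part x t u)) = chain_diff L u - tail x u" .
  have "chain_diff L (lift x u) = (\<Sum>t | x \<prec> t. fill x t u)"
    by (subst chain_diff_supported[where A = "{t. x \<prec> t}"]) (auto simp: tail_lift covD)
  also have "\<dots> = (\<Sum>t | x \<prec> t. prepend x (chain_diff L (part x t u))) - (\<Sum>t | x \<prec> t. part x t u)"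
    unfolding fill_def by (rule sum_subtractf)
  also have "(\<Sum>t | x \<prec> t. prepend x (chain_diff L (part x t u))) =
      prepend x (\<Sum>t | x \<prec> t. chain_diff L (part x t u))"
    by (rule fun_list_eqI) (auto simp: sum_fun_apply)
  also have "\<dots> = prepend x (chain_diff L u) - prepend x (tail x u)"
    unfolding diffs by (rule fun_list_eqI) auto
  finally show ?thesis unfolding parts by (simp add: fun_eq_iff)
qed

end

section \<open>The homotopy between the Euler operator and zero\<close>

text \<open>The modules are mere subgroups and the maps merely additive at this stage.
  \<open>part_U\<close> is the rank two compatibility that starts the induction: it puts the
  \<open>x\<close>-component of the first fills into \<open>U x\<close>.\<close>

locale euler_family = geometric_poset L for L :: "'l ranked_poset" +
  fixes U :: "'l \<Rightarrow> 'm::ab_group_add set" and \<theta> :: "'l \<Rightarrow> 'm \<Rightarrow> 'm"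
  assumes zero_U: "\<lbrakk>x \<in> elts L; rk L x = 1\<rbrakk> \<Longrightarrow> 0 \<in> U x"
    and diff_U: "\<lbrakk>x \<in> elts L; rk L x = 1; f \<in> U x; g \<in> U x\<rbrakk> \<Longrightarrow> f - g \<in> U x"
    and additive_theta: "additive (\<theta> a)"
    and theta_U: "\<lbrakk>a \<in> elts L; rk L a = 1\<rbrakk> \<Longrightarrow> \<theta> a f \<in> U a"
    and part_U: "\<lbrakk>x \<in> elts L; rk L x = 1; covered_by L x t; f \<in> U x\<rbrakk> \<Longrightarrow>
      (\<Sum>z | covered_by L z t \<and> z \<noteq> x. \<theta> z f) \<in> U x"
begin

definition euler :: "'m \<Rightarrow> 'm" where
  "euler f = (\<Sum>a | a \<in> elts L \<and> rk L a = 1. \<theta> a f)"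

text \<open>The map \<open>D\<close> of degree one. The tail of \<open>w\<close> at \<open>x\<close>
  is the boundary of its component there, so the recursion applies \<open>D\<close> to that boundary
  and lifts the result along the covers of \<open>x\<close>.\<close>

primrec htpy :: "nat \<Rightarrow> ('l list \<Rightarrow> 'm) \<Rightarrow> 'l list \<Rightarrow> 'm" where
  "htpy 0 w = (\<Sum>a | a \<in> elts L \<and> rk L a = 1. prepend a (at_nil (\<theta> a (w []))))"
| "htpy (Suc i) w = (\<Sum>x\<in>elts L. lift x (htpy i (tail x w)))"

declare htpy.simps [simp del]

lemma theta_0 [simp]: "\<theta> a 0 = 0"
  by (rule additive.zero[OF additive_theta])

lemma theta_add: "\<theta> a (f + g) = \<theta> a f + \<theta> a g"
  by (rule additive.add[OF additive_theta])

lemma additive_euler: "additive euler"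
  by (rule additive.intro) (simp add: euler_def theta_add sum.distrib)

lemma euler_0 [simp]: "euler 0 = 0"
  by (rule additive.zero[OF additive_euler])

lemma additive_htpy: "additive (htpy i)"
proof (rule additive.intro)
  show "htpy i (v + w) = htpy i v + htpy i w" for v w
  proof (induction i arbitrary: v w)
    case 0
    show ?case
      by (simp only: htpy.simps plus_fun_apply theta_add at_nil_add prepend_add sum.distrib)
  next
    case (Suc i)
    then show ?case
      by (simp only: htpy.simps tail_simps lift_add sum.distrib)
  qed
qed

lemma htpy_0 [simp]: "htpy i 0 = 0"
  by (rule additive.zero[OF additive_htpy])

lemma chain_diff_diff: "chain_diff L (v - w) = chain_diff L v - chain_diff L (w :: _ \<Rightarrow> _::ab_group_add)"
  by (simp add: chain_diff_tail sum_subtractf)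

lemma zero_cycles: "x \<in> elts L \<Longrightarrow> rk L x = Suc i \<Longrightarrow> 0 \<in> cycles L U i x"
proof (induction i arbitrary: x)
  case 0
  then have "at_nil 0 \<in> cycles L U 0 x" using zero_U[of x] by simp
  then show ?case by (simp only: at_nil_0)
next
  case (Suc i)
  then show ?case unfolding cycles_Suc_iff using rank_covered covD by fastforce
qed

lemma diff_cycles:
  "x \<in> elts L \<Longrightarrow> rk L x = Suc i \<Longrightarrow> v \<in> cycles L U i x \<Longrightarrow> w \<in> cycles L U i x \<Longrightarrow>
    v - w \<in> cycles L U i x"
proof (induction i arbitrary: x v w)
  case 0
  obtain f g where "v = at_nil f" "w = at_nil g" "f \<in> U x" "g \<in> U x" using 0 by auto
  then have "at_nil (f - g) \<in> cycles L U 0 x" "v - w = at_nil (f - g)"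
    using 0 diff_U[of x] by (simp_all add: at_nil_def fun_eq_iff)
  then show ?case by (simp only:)
next
  case (Suc i)
  have "tail y v - tail y w \<in> cycles L U i y" if "y \<prec> x" for y
    using Suc.prems that rank_covered[OF that] covD(1)[OF that] unfolding cycles_Suc_iff
    by (intro Suc.IH) simp_all
  then show ?case using Suc.prems unfolding cycles_Suc_iff
    by (simp add: chain_diff_diff)
qed

lemma uminus_cycles:
  assumes "x \<in> elts L" "rk L x = Suc i" "v \<in> cycles L U i x"
  shows "- v \<in> cycles L U i x"
  using diff_cycles[OF assms(1,2) zero_cycles[OF assms(1,2)] assms(3)] by simp

lemma add_cycles:
  assumes "x \<in> elts L" "rk L x = Suc i" "v \<in> cycles L U i x" "w \<in> cycles L U i x"
  shows "v + w \<in> cycles L U i x"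
  using diff_cycles[OF assms(1-3) uminus_cycles[OF assms(1,2,4)]] by simp

lemma sum_cycles:
  assumes "x \<in> elts L" "rk L x = Suc i" "\<And>j. j \<in> J \<Longrightarrow> v j \<in> cycles L U i x"
  shows "(\<Sum>j\<in>J. v j) \<in> cycles L U i x"
  using assms(3)
  by (induction J rule: infinite_finite_induct)
    (auto intro: zero_cycles[OF assms(1,2)] add_cycles[OF assms(1,2)])

text \<open>The induction invariant for a cycle \<open>v\<close> attached to \<open>x\<close>. Its
  support clause makes \<open>chain_diff_lift\<close> applicable, and its last clause controls the
  component of \<open>fill x t\<close> at \<open>x\<close>.\<close>

definition htpy_on :: "nat \<Rightarrow> 'l \<Rightarrow> ('l list \<Rightarrow> 'm) \<Rightarrow> bool" where
  "htpy_on i x v \<longleftrightarrow>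
     htpy i v [] = 0 \<and>
     (\<forall>z. tail z (htpy i v) \<noteq> 0 \<longrightarrow> (\<exists>y. y \<prec> x \<and> y \<prec> z)) \<and>
     (\<forall>z. z \<in> elts L \<longrightarrow> rk L z = Suc i \<longrightarrow> tail z (htpy i v) \<in> cycles L U i z) \<and>
     chain_diff L (htpy i v) = euler \<circ> v \<and>
     (\<forall>t. x \<prec> t \<longrightarrow> chain_diff L (part x t (htpy i v)) \<in> cycles L U i x)"

text \<open>The boundary vanishes by the design of \<open>fill\<close>. The component at
  \<open>x\<close> is handled by the last clause of \<open>htpy_on\<close>, the other components by
  its third clause.\<close>

lemma fill_cycles:
  assumes "htpy_on i x v" "x \<in> elts L" "rk L x = Suc i" "x \<prec> t"
  shows "fill x t (htpy i v) \<in> cycles L U (Suc i) t"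
proof -
  let ?u = "htpy i v"
  have "tail y (fill x t ?u) \<in> cycles L U i y" if y: "y \<prec> t" for y
  proof -
    have r: "y \<in> elts L" "rk L y = Suc i"
      using covD(1)[OF y] rank_covered[OF y] rank_covered[OF assms(4)] assms(3) by simp_all
    show ?thesis
      using assms(1,4) y r uminus_cycles[OF r, of "tail y ?u"]
      by (simp add: fill_def tail_part htpy_on_def)
  qed
  moreover have "tail y (fill x t ?u) = 0" if "\<not> y \<prec> t" for y
    using that assms(4) by (auto simp: fill_def tail_part)
  moreover have "chain_diff L (fill x t ?u) = 0"
    unfolding fill_def chain_diff_diff
    by (subst chain_diff_prepend) (use finite_elts assms(2) in simp_all)
  ultimately show ?thesis
    unfolding cycles_Suc_iff by (simp add: fill_def)
qed

text \<open>The passage to the next degree, for \<open>v\<close> spread over a set \<open>A\<close>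
  of elements of equal rank and not necessarily a cycle. With \<open>A\<close> the lower covers of
  one element it drives the induction; with \<open>A\<close> a whole rank level it gives the
  homotopy formula on the complex.\<close>

lemma htpy_Suc:
  assumes A: "A \<subseteq> elts L" "\<forall>x\<in>A. rk L x = Suc i"
    and v: "v [] = 0" "\<forall>x\<in>A. htpy_on i x (tail x v)" "\<forall>x. x \<notin> A \<longrightarrow> tail x v = 0"
  shows "htpy (Suc i) v [] = 0"
    and "tail t (htpy (Suc i) v) = (\<Sum>x | x \<in> A \<and> x \<prec> t. fill x t (htpy i (tail x v)))"
    and "t \<in> elts L \<Longrightarrow> rk L t = Suc (Suc i) \<Longrightarrow> tail t (htpy (Suc i) v) \<in> cycles L U (Suc i) t"
    and "chain_diff L (htpy (Suc i) v) = (euler \<circ> v) - htpy i (chain_diff L v)"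
proof -
  have finA: "finite A" using A(1) finite_elts finite_subset by blast
  have eq: "htpy (Suc i) v = (\<Sum>x\<in>A. lift x (htpy i (tail x v)))"
  proof -
    have "lift x (htpy i (tail x v)) = 0" if "x \<notin> A" for x
    proof -
      have "lift x 0 = (0 :: 'l list \<Rightarrow> 'm)" using lift_add[of x 0 "0 :: 'l list \<Rightarrow> 'm"] by simp
      then show ?thesis using v(3) that by simp
    qed
    then show ?thesis unfolding htpy.simps
      by (intro sum.mono_neutral_right) (use A(1) finite_elts in auto)
  qed
  show "htpy (Suc i) v [] = 0" unfolding eq by (simp add: sum_fun_apply)
  show tl: "tail t (htpy (Suc i) v) = (\<Sum>x | x \<in> A \<and> x \<prec> t. fill x t (htpy i (tail x v)))" for t
    unfolding eq tail_sum tail_lift using finA by (simp add: sum.inter_filter)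
  show "tail t (htpy (Suc i) v) \<in> cycles L U (Suc i) t" if "t \<in> elts L" "rk L t = Suc (Suc i)"
    unfolding tl by (rule sum_cycles[OF that]) (use A fill_cycles v(2) in auto)
  \<comment> \<open>Sum \<open>chain_diff_lift\<close> over \<open>A\<close>. By the invariant,
    \<partial>D acts on each tail as the Euler operator, which produces \<partial>D = E -
    D\<partial> one degree higher.\<close>
  have "chain_diff L (htpy (Suc i) v) = (\<Sum>x\<in>A. chain_diff L (lift x (htpy i (tail x v))))"
    unfolding eq by (rule chain_diff_sum)
  also have "\<dots> = (\<Sum>x\<in>A. prepend x (euler \<circ> tail x v) - htpy i (tail x v))"
  proof (rule sum.cong[OF refl])
    fix x assume x: "x \<in> A"
    then have h: "htpy_on i x (tail x v)" using v(2) by blast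
    have "chain_diff L (lift x (htpy i (tail x v))) =
        prepend x (chain_diff L (htpy i (tail x v))) - htpy i (tail x v)"
      by (rule chain_diff_lift) (use h A(1) x in \<open>auto simp: htpy_on_def\<close>)
    then show "chain_diff L (lift x (htpy i (tail x v))) = prepend x (euler \<circ> tail x v) - htpy i (tail x v)"
      using h by (simp add: htpy_on_def)
  qed
  also have "\<dots> = (\<Sum>x\<in>A. prepend x (euler \<circ> tail x v)) - htpy i (\<Sum>x\<in>A. tail x v)"
    unfolding additive.sum[OF additive_htpy] by (rule sum_subtractf)
  also have "(\<Sum>x\<in>A. tail x v) = chain_diff L v"
    by (rule chain_diff_supported[symmetric]) (use v(3) A(1) in auto)
  also have "(\<Sum>x\<in>A. prepend x (euler \<circ> tail x v)) = euler \<circ> v"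
  proof (rule fun_list_eqI)
    show "tail y (\<Sum>x\<in>A. prepend x (euler \<circ> tail x v)) = tail y (euler \<circ> v)" for y
    proof (cases "y \<in> A")
      case True
      then show ?thesis using finA by (simp add: sum.delta) (simp add: fun_eq_iff tail_apply)
    next
      case False
      then have "v (y # c) = 0" for c using v(3) by (metis tail_apply zero_fun_apply)
      then show ?thesis using finA False by (simp add: sum.delta) (simp add: fun_eq_iff tail_apply)
    qed
  qed (simp add: sum_fun_apply v(1))
  finally show "chain_diff L (htpy (Suc i) v) = (euler \<circ> v) - htpy i (chain_diff L v)" .
qed

lemma euler_comp_0 [simp]: "euler \<circ> 0 = 0"
  by (simp add: fun_eq_iff tail_apply)

text \<open>In rank one, any two atoms cover the bottom and the last clause is
  \<open>part_U\<close>. In higher rank the delicate clause is again the last: the boundary of the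
  part below \<open>t\<close> must have no component outside the lower covers of
  \<open>x\<close>.\<close>

lemma htpy_on_cycles:
  "x \<in> elts L \<Longrightarrow> rk L x = Suc i \<Longrightarrow> v \<in> cycles L U i x \<Longrightarrow> htpy_on i x v"
proof (induction i arbitrary: x v)
  case 0
  then obtain f where f: "v = at_nil f" "f \<in> U x" by auto
  let ?A = "{a. a \<in> elts L \<and> rk L a = 1}"
  let ?u = "htpy 0 v"
  have tl: "tail z ?u = (if z \<in> ?A then at_nil (\<theta> z f) else 0)" for z
    by (simp add: htpy.simps f(1) sum.delta)
  have sum_at_nil: "(\<Sum>a\<in>B. at_nil (g a)) = at_nil (\<Sum>a\<in>B. g a :: 'm)" for g and B :: "'l set"
    by (simp add: fun_eq_iff sum_fun_apply at_nil_def)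
  have "chain_diff L ?u = (\<Sum>a\<in>?A. tail a ?u)"
    by (rule chain_diff_supported) (auto simp: tl)
  also have "\<dots> = at_nil (euler f)"
    unfolding euler_def sum_at_nil[symmetric] by (rule sum.cong) (simp_all add: tl)
  also have "\<dots> = euler \<circ> v" by (simp add: f(1) at_nil_def fun_eq_iff)
  finally have d: "chain_diff L ?u = euler \<circ> v" .
  have "chain_diff L (part x t ?u) \<in> cycles L U 0 x" if t: "x \<prec> t" for t
  proof -
    have "z \<in> ?A" if "z \<prec> t" for z
      using that 0(2) rank_covered[OF t] rank_covered[OF that] covD(1)[OF that] by simp
    then have "chain_diff L (part x t ?u) = at_nil (\<Sum>z | z \<prec> t \<and> z \<noteq> x. \<theta> z f)"
      unfolding chain_diff_part sum_at_nil[symmetric] by (intro sum.cong) (simp_all add: tl)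
    then show ?thesis using part_U[of x t f] 0 t f by simp
  qed
  moreover have "\<exists>y. y \<prec> x \<and> y \<prec> z" if "tail z ?u \<noteq> 0" for z
  proof -
    have "z \<in> ?A" using that tl[of z] by metis
    then show ?thesis using atoms_covered[of x z] 0 by simp
  qed
  moreover have "tail z ?u \<in> cycles L U 0 z" if "z \<in> elts L" "rk L z = Suc 0" for z
    using that theta_U[of z f] tl[of z] by simp
  moreover have "?u [] = 0" by (simp add: htpy.simps sum_fun_apply)
  ultimately show ?case unfolding htpy_on_def using d by blast
next
  case (Suc i)
  let ?u = "htpy (Suc i) v"
  let ?A = "{y. y \<prec> x}"
  have A: "?A \<subseteq> elts L" "\<forall>y\<in>?A. rk L y = Suc i"
    using covD Suc.prems(2) rank_covered by fastforce+
  have v: "v [] = 0" "\<forall>y\<in>?A. htpy_on i y (tail y v)" "\<forall>y. y \<notin> ?A \<longrightarrow> tail y v = 0"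
    "chain_diff L v = 0"
    using Suc.prems(3) Suc.IH A unfolding cycles_Suc_iff by blast+
  note u = htpy_Suc[OF A v(1-3)]
  \<comment> \<open>Since \<open>v\<close> is a cycle, the term D\<partial> of the homotopy formula
    vanishes.\<close>
  have d: "chain_diff L ?u = euler \<circ> v" using u(4) v(4) by simp
  have supp: "\<exists>y. y \<prec> x \<and> y \<prec> z" if "tail z ?u \<noteq> 0" for z
  proof (rule ccontr)
    assume "\<nexists>y. y \<prec> x \<and> y \<prec> z"
    then have "{y. y \<prec> x \<and> y \<prec> z} = {}" by blast
    then show False using that unfolding u(2) mem_Collect_eq by (metis sum.empty)
  qed
  have zcyc: "tail z ?u \<in> cycles L U (Suc i) z" if "z \<in> elts L" "rk L z = Suc (Suc i)" for z
    by (rule u(3)) fact+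
  have "chain_diff L (part x t ?u) \<in> cycles L U (Suc i) x" if t: "x \<prec> t" for t
  proof -
    let ?B = "{z. z \<prec> t \<and> z \<noteq> x}"
    let ?q = "\<Sum>z\<in>?B. tail z ?u"
    have B: "z \<in> elts L" "rk L z = Suc (Suc i)" if "z \<in> ?B" for z
      using that rank_covered[OF t] rank_covered[of z t] covD(1)[of z t] Suc.prems(2) by simp_all
    have z: "tail z ?u [] = 0" "\<And>y. y \<prec> z \<Longrightarrow> tail y (tail z ?u) \<in> cycles L U i y"
        "\<And>y. \<not> y \<prec> z \<Longrightarrow> tail y (tail z ?u) = 0" "chain_diff L (tail z ?u) = 0"
      if "z \<in> elts L" "rk L z = Suc (Suc i)" for z
      using zcyc[OF that] unfolding cycles_Suc_iff by blast+
    have "?q [] = 0" unfolding sum_fun_apply using z(1) B by (intro sum.neutral) blast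
    moreover have "chain_diff L ?q = 0"
      unfolding chain_diff_sum using z(4) B by (intro sum.neutral) blast
    moreover have "tail y ?q \<in> cycles L U i y" if y: "y \<prec> x" for y
      unfolding tail_sum
    proof (rule sum_cycles)
      show r: "y \<in> elts L" "rk L y = Suc i" using A y by blast+
      show "tail y (tail z ?u) \<in> cycles L U i y" if "z \<in> ?B" for z
        using z(2,3)[OF B[OF that], of y] zero_cycles[OF r] by metis
    qed
    \<comment> \<open>If \<open>y\<close> is covered by some member of \<open>?B\<close>, then by
      \<open>cov_transfer\<close> every \<open>z\<close> contributing at \<open>y\<close> belongs to
      \<open>?B\<close>. The sum may then run over all of \<open>L\<close>, where it is the
      \<open>y\<close>-component of the full boundary \<open>euler \<circ> v\<close>, and this
      vanishes together with the one of \<open>v\<close>.\<close>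
    moreover have "tail y ?q = 0" if y: "\<not> y \<prec> x" for y
    proof (cases "\<exists>z' \<in> ?B. y \<prec> z'")
      case False
      then show ?thesis unfolding tail_sum using z(3) B by (intro sum.neutral) blast
    next
      case True
      then obtain z' where z': "y \<prec> z'" "z' \<prec> t" by blast
      have "tail y (tail z ?u) = 0" if zz: "z \<in> elts L - ?B" for z
      proof (rule ccontr)
        assume n: "tail y (tail z ?u) \<noteq> 0"
        then have "tail z ?u \<noteq> 0" using tail_simps(1) by metis
        then obtain y' where y': "y' \<prec> x" "y' \<prec> z" using supp by blast
        then have "rk L z = Suc (Suc i)" using rank_covered A(2) y'(1) by simp
        then have "y \<prec> z" using z(3)[of z y] n zz by blast
        then show False using cov_transfer[OF y' _ y z' t] y zz by blast
      qed
      then have "tail y ?q = (\<Sum>z\<in>elts L. tail y (tail z ?u))"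
        unfolding tail_sum by (intro sum.mono_neutral_left) (auto simp: finite_elts covD)
      also have "\<dots> = tail y (euler \<circ> v)"
        unfolding d[symmetric] by (simp only: chain_diff_tail tail_sum)
      also have "\<dots> = euler \<circ> tail y v" by (simp add: fun_eq_iff tail_apply)
      also have "\<dots> = 0" using v(3) y by simp
      finally show ?thesis .
    qed
    ultimately show ?thesis unfolding chain_diff_part cycles_Suc_iff by blast
  qed
  then show ?case unfolding htpy_on_def
    by (intro conjI allI impI u(1) supp zcyc d)
qed

text \<open>The preimage is \<open>D v\<close>: on a cycle the homotopy formula reduces to
  \<partial>D = E.\<close>

theorem euler_image_boundary:
  assumes v: "v \<in> chain_module L (minimal_complex L U\<^sub>0 U) (Suc i)" and "chain_diff L v = 0"
  shows "euler \<circ> v \<in> chain_diff L ` chain_module L (minimal_complex L U\<^sub>0 U) (Suc (Suc i))"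
proof -
  let ?A = "{x \<in> elts L. rk L x = Suc i}"
  have A: "?A \<subseteq> elts L" "\<forall>x\<in>?A. rk L x = Suc i" by auto
  have "v [] = 0" "\<forall>y\<in>?A. htpy_on i y (tail y v)" "\<forall>y. y \<notin> ?A \<longrightarrow> tail y v = 0"
    using v unfolding chain_module_minimal_complex
    by (auto simp: sum_sub_prepend_iff intro: htpy_on_cycles)
  note u = htpy_Suc[OF A this]
  have "tail t (htpy (Suc i) v) = 0" if "t \<notin> {x \<in> elts L. rk L x = Suc (Suc i)}" for t
  proof -
    have "{x \<in> ?A. x \<prec> t} = {}" using that covD rank_covered by fastforce
    then show ?thesis using u(2)[of t] by (simp only: sum.empty)
  qed
  then have "htpy (Suc i) v \<in> chain_module L (minimal_complex L U\<^sub>0 U) (Suc (Suc i))"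
    unfolding chain_module_minimal_complex using u(1,3) by (simp add: sum_sub_prepend_iff del: cycles.simps)
  moreover have "chain_diff L (htpy (Suc i) v) = euler \<circ> v" using u(4) assms(2) by simp
  ultimately show ?thesis by (intro image_eqI[where x = "htpy (Suc i) v"]) simp_all
qed

end

section \<open>The operator products (E - 1)...(E - N)\<close>

primrec shifted_prod :: "('s \<Rightarrow> 's) \<Rightarrow> nat \<Rightarrow> 's \<Rightarrow> 's::comm_ring_1" where
  "shifted_prod E 0 f = f"
| "shifted_prod E (Suc N) f = shifted_prod E N (E f - of_nat (Suc N) * f)"

lemma additive_of_nat:
  fixes E :: "'s::comm_ring_1 \<Rightarrow> 's"
  assumes "additive E" shows "E (of_nat k * f) = of_nat k * E f"
  by (induction k) (simp_all add: additive.zero[OF assms] additive.add[OF assms] distrib_right)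

lemma additive_shifted_prod:
  assumes "additive E" shows "additive (shifted_prod E N)"
proof (rule additive.intro)
  show "shifted_prod E N (f + g) = shifted_prod E N f + shifted_prod E N g" for f g
  proof (induction N arbitrary: f g)
    case (Suc N)
    have "E (f + g) - of_nat (Suc N) * (f + g) =
        (E f - of_nat (Suc N) * f) + (E g - of_nat (Suc N) * g)"
      by (simp add: additive.add[OF assms] algebra_simps)
    then show ?case by (simp only: shifted_prod.simps Suc.IH)
  qed simp
qed

text \<open>All factors are integer polynomials in the one additive operator \<open>E\<close>, so
  they commute.\<close>

lemma shifted_prod_commute:
  assumes "additive E"
  shows "shifted_prod E N (E f - of_nat k * f) = E (shifted_prod E N f) - of_nat k * shifted_prod E N f"
proof (induction N arbitrary: f)
  case (Suc N)
  note E = additive.add[OF assms] additive.diff[OF assms] additive_of_nat[OF assms]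
  have "E (E f - of_nat k * f) - of_nat (Suc N) * (E f - of_nat k * f) =
      E (E f - of_nat (Suc N) * f) - of_nat k * (E f - of_nat (Suc N) * f)"
    unfolding E by (simp add: algebra_simps)
  then show ?case by (simp only: shifted_prod.simps Suc.IH)
qed simp

lemma shifted_prod_mono:
  assumes "additive E" "shifted_prod E N f = 0" "N \<le> M"
  shows "shifted_prod E M f = 0"
  using assms(3)
proof (induction rule: dec_induct)
  case (step M)
  then show ?case
    using shifted_prod_commute[OF assms(1), of M f "Suc M"] additive.zero[OF assms(1)] by simp
qed (rule assms(2))

section \<open>Exactness when such products annihilate the chains\<close>

locale euler_ring_family = euler_family L U \<theta>
  for L :: "'l ranked_poset" and U :: "'l \<Rightarrow> 's::comm_ring_1 set" and \<theta> +
  assumes ideal_U: "x \<in> elts L \<Longrightarrow> module.subspace (*) (U x)"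
    and nat_unit: "\<exists>c. c * of_nat (Suc k) = (1::'s)"
    and shifted_prod_U: "\<lbrakk>x \<in> elts L; rk L x = 1; f \<in> U x\<rbrakk> \<Longrightarrow> \<exists>N. shifted_prod euler N f = 0"
begin

interpretation ring: module "(*) :: 's \<Rightarrow> 's \<Rightarrow> 's"
  by unfold_locales (simp_all add: algebra_simps)

interpretation fun_mod: module "pointwise (*) :: 's \<Rightarrow> ('l list \<Rightarrow> 's) \<Rightarrow> _"
  by (rule module_pointwise) (rule ring.module_axioms)

abbreviation "W \<equiv> minimal_complex L UNIV U"

lemma shifted_prod_0 [simp]: "shifted_prod euler N 0 = 0"
  by (rule additive.zero[OF additive_shifted_prod[OF additive_euler]])

lemma shifted_prod_family:
  assumes "finite A" "v [] = 0" "\<forall>y. y \<notin> A \<longrightarrow> tail y v = 0"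
    and "\<forall>y\<in>A. \<exists>N. \<forall>c. shifted_prod euler N (tail y v c) = 0"
  shows "\<exists>N. \<forall>c. shifted_prod euler N (v c) = 0"
proof -
  obtain N where N: "\<And>y c. y \<in> A \<Longrightarrow> shifted_prod euler (N y) (v (y # c)) = 0"
    using assms(4) unfolding tail_apply by metis
  \<comment> \<open>The sum of the finitely many bounds dominates each of them, and further factors
    do no harm by \<open>shifted_prod_mono\<close>.\<close>
  have "shifted_prod euler (sum N A) (v c) = 0" for c
  proof (cases c)
    case (Cons y c')
    show ?thesis
    proof (cases "y \<in> A")
      case True
      then have "N y \<le> sum N A" using assms(1) by (intro member_le_sum) simp_all
      then show ?thesis
        unfolding Cons by (rule shifted_prod_mono[OF additive_euler N[OF True]])
    next
      case False
      then have "v c = 0" using assms(3) Cons by (metis tail_apply zero_fun_apply)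
      then show ?thesis by simp
    qed
  qed (simp add: assms(2))
  then show ?thesis by blast
qed

lemma shifted_prod_cycles:
  "x \<in> elts L \<Longrightarrow> rk L x = Suc i \<Longrightarrow> v \<in> cycles L U i x \<Longrightarrow>
    \<exists>N. \<forall>c. shifted_prod euler N (v c) = 0"
proof (induction i arbitrary: x v)
  case 0
  then obtain f where f: "v = at_nil f" "f \<in> U x" by auto
  then obtain N where "shifted_prod euler N f = 0"
    using shifted_prod_U[of x f] 0 by auto
  then show ?case by (intro exI[of _ N]) (simp add: f at_nil_def)
next
  case (Suc i)
  have "\<exists>N. \<forall>c. shifted_prod euler N (tail y v c) = 0" if y: "y \<prec> x" for y
    by (rule Suc.IH[of y])
      (use Suc.prems rank_covered[OF y] covD(1)[OF y] y in \<open>unfold cycles_Suc_iff, simp_all\<close>)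
  then show ?case
    using Suc.prems(3) unfolding cycles_Suc_iff
    by (intro shifted_prod_family[where A = "{y. y \<prec> x}"]) simp_all
qed

lemma compatibly_graded_W: "compatibly_graded (pointwise (*)) L W"
  by (rule minimal_complex_compatibly_graded)
    (simp_all add: ring.module_axioms ranked ideal_U)

lemma diff_W [simp]: "diff W i = chain_diff L"
  by (simp add: minimal_complex_def)

lemma boundary_cycle:
  assumes "v \<in> chain_diff L ` chain_module L W (Suc (Suc i))"
  shows "v \<in> chain_module L W (Suc i)" "chain_diff L v = 0"
proof -
  have "linear_between (pointwise (*)) (chain_module L W (Suc (Suc i))) (chain_module L W (Suc i)) (chain_diff L)"
    using compatibly_graded_W unfolding compatibly_graded_def diff_W
    by (metis One_nat_def Suc_le_mono diff_Suc_1 le0)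
  then show "v \<in> chain_module L W (Suc i)"
    using assms unfolding linear_between_def by blast
  show "chain_diff L v = 0"
    using compatibly_graded_W assms unfolding compatibly_graded_def diff_W
    by (metis (no_types, lifting) One_nat_def Suc_eq_plus1 Suc_le_mono imageE le0)
qed

lemma subspace_chain_module: "fun_mod.subspace (chain_module L W i)"
  unfolding chain_module_def
  by (rule subspace_sum_sub)
    (use compatibly_graded_W in \<open>auto simp: compatibly_graded_def fun_mod.module_axioms\<close>)

lemma subspace_boundaries: "fun_mod.subspace (chain_diff L ` chain_module L W i)"
  by (rule subspace_image[OF fun_mod.module_axioms fun_mod.module_axioms subspace_chain_module])
    (simp_all only: chain_diff_0 linear_chain_diff ring.module_axioms)

text \<open>Induction on the number of factors. The cycle (E - (N + 1)) v is annihilated by one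
  factor fewer, hence is a boundary; so is E v by \<open>euler_image_boundary\<close>. Their
  difference is (N + 1) v, and N + 1 is invertible.\<close>

lemma cycle_boundary:
  assumes "v \<in> chain_module L W (Suc i)" "chain_diff L v = 0" "\<And>c. shifted_prod euler N (v c) = 0"
  shows "v \<in> chain_diff L ` chain_module L W (Suc (Suc i))" (is "v \<in> ?B")
  using assms
proof (induction N arbitrary: v)
  case 0
  then have "v = 0" by (simp add: fun_eq_iff)
  then show ?case using fun_mod.subspace_0[OF subspace_boundaries] by (simp only:)
next
  case (Suc N)
  let ?k = "of_nat (Suc N) :: 's"
  have E: "euler \<circ> v \<in> ?B" by (rule euler_image_boundary) fact+
  let ?w = "(euler \<circ> v) - pointwise (*) ?k v"
  have w: "?w \<in> ?B"
  proof (rule Suc.IH)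
    show "?w \<in> chain_module L W (Suc i)"
      by (intro fun_mod.subspace_diff fun_mod.subspace_scale subspace_chain_module boundary_cycle E Suc.prems)
    show "chain_diff L ?w = 0"
      unfolding chain_diff_diff boundary_cycle(2)[OF E] linear_chain_diff(2)[OF ring.module_axioms] Suc.prems(2)
      by simp
    show "shifted_prod euler N (?w c) = 0" for c
      using Suc.prems(3)[of c] by (simp add: pointwise_def)
  qed
  have "pointwise (*) ?k v = (euler \<circ> v) - ?w" by simp
  then have "pointwise (*) ?k v \<in> ?B"
    using fun_mod.subspace_diff[OF subspace_boundaries E w] by simp
  moreover obtain c where "c * ?k = 1" using nat_unit by blast
  then have "v = pointwise (*) c (pointwise (*) ?k v)"
    by (simp add: pointwise_def fun_eq_iff mult.assoc[symmetric])
  ultimately show ?case using fun_mod.subspace_scale[OF subspace_boundaries] by metis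
qed

theorem exact_minimal_complex: "exact_complex L W"
  unfolding exact_complex_def diff_W
proof
  fix i assume "i \<in> {1..total_rank L}"
  then obtain j where i: "i = Suc j" by (cases i) auto
  show "{v \<in> chain_module L W i. chain_diff L v = 0} = chain_diff L ` chain_module L W (i + 1)"
  proof (intro equalityI subsetI CollectI conjI)
    fix v assume v: "v \<in> {v \<in> chain_module L W i. chain_diff L v = 0}"
    \<comment> \<open>A chain of one degree is a finite family of cycles, so one product annihilates
      all its values.\<close>
    then have "\<exists>N. \<forall>c. shifted_prod euler N (v c) = 0"
      unfolding i chain_module_minimal_complex
      by (intro shifted_prod_family[where A = "{x \<in> elts L. rk L x = Suc j}"])
        (auto simp: sum_sub_prepend_iff intro: shifted_prod_cycles)
    then show "v \<in> chain_diff L ` chain_module L W (i + 1)"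
      using v cycle_boundary[of v j] unfolding i by auto
  next
    fix v assume "v \<in> chain_diff L ` chain_module L W (i + 1)"
    then have "v \<in> chain_diff L ` chain_module L W (Suc (Suc j))" by (simp add: i)
    then show "v \<in> chain_module L W i" "chain_diff L v = 0"
      unfolding i by (rule boundary_cycle)+
  qed
qed

end

section \<open>Intersection lattices are geometric\<close>

context vector_space
begin

text \<open>The dual space sits inside the space of all functions, which need not be
  finite-dimensional; dimensions are therefore compared relative to a finite spanning set
  \<open>F\<close>.\<close>

lemma finite_basis_in_span:
  assumes "finite F" "S \<subseteq> span F"
  obtains B where "B \<subseteq> S" "independent B" "S \<subseteq> span B" "card B = dim S" "finite B"
  by (metis assms basis_exists independent_span_bound order_trans)

lemma dim_mono_span:
  assumes "finite F" "T \<subseteq> span F" "S \<subseteq> T" shows "dim S \<le> dim T"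
proof -
  obtain B where "T \<subseteq> span B" "card B = dim T" "finite B"
    using finite_basis_in_span[OF assms(1,2)] by metis
  then show ?thesis using dim_le_card[of S B] assms(3) by simp
qed

lemma dim_insert_in_span:
  assumes "finite F" "S \<subseteq> span F" "x \<notin> span S" shows "dim (insert x S) = Suc (dim S)"
proof -
  obtain B where B: "B \<subseteq> S" "independent B" "S \<subseteq> span B" "card B = dim S" "finite B"
    by (rule finite_basis_in_span[OF assms(1,2)])
  then have "x \<notin> span B" using assms(3) span_mono by blast
  moreover have "x \<notin> B" using calculation span_base by blast
  moreover have "insert x S \<subseteq> span (insert x B)"
    using B(3) span_mono[of B "insert x B"] span_base[of x "insert x B"] by blast
  ultimately show ?thesis
    using B by (intro dim_unique[of "insert x B"]) (auto simp: independent_insert)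
qed

lemma dim_strict_mono_span:
  assumes "finite F" "T \<subseteq> span F" "S \<subset> T" "subspace S" shows "dim S < dim T"
proof -
  obtain x where x: "x \<in> T" "x \<notin> S" using assms(3) by blast
  then have "x \<notin> span S" using assms(4) by (metis span_eq_iff)
  then have "dim (insert x S) = Suc (dim S)"
    using assms by (intro dim_insert_in_span[of F]) auto
  moreover have "dim (insert x S) \<le> dim T"
    using assms x by (intro dim_mono_span[of F]) auto
  ultimately show ?thesis by simp
qed

text \<open>If \<open>X\<close> is not contained in \<open>H\<close>, any \<open>a\<close> in
  \<open>X\<close> outside \<open>H\<close> spans \<open>D\<close> together with \<open>H\<close>.
  Subtracting multiples of \<open>a\<close> moves elements of \<open>X\<close> into
  \<open>X \<inter> H\<close>, so \<open>a\<close> and a basis of \<open>X \<inter> H\<close> span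
  \<open>X\<close>.\<close>

lemma dim_Int_hyperplane:
  assumes F: "finite F" "D \<subseteq> span F"
    and H: "subspace H" "H \<subseteq> D" "dim D \<le> Suc (dim H)" and X: "subspace X" "X \<subseteq> D" and D: "subspace D"
  shows "dim X \<le> Suc (dim (X \<inter> H))"
proof (cases "X \<subseteq> H")
  case True
  then show ?thesis by (simp add: Int_absorb2)
next
  case False
  then obtain a where a: "a \<in> X" "a \<notin> H" by blast
  have "D \<subseteq> span (insert a H)"
  proof (rule ccontr)
    assume "\<not> D \<subseteq> span (insert a H)"
    then have "span (insert a H) \<subset> D"
      using a X H(2) span_minimal[OF _ D, of "insert a H"] by blast
    from dim_strict_mono_span[OF F this subspace_span]
    have "dim (insert a H) < dim D" by simp
    moreover have "a \<notin> span H" using a H(1) by (metis span_eq_iff)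
    then have "dim (insert a H) = Suc (dim H)"
      using H F by (intro dim_insert_in_span[of F]) auto
    ultimately show False using H(3) by simp
  qed
  have "X \<subseteq> span (insert a (X \<inter> H))"
  proof
    fix x assume x: "x \<in> X"
    then have "x \<in> span (insert a H)" using \<open>D \<subseteq> span (insert a H)\<close> X(2) by blast
    then obtain k where "x - scale k a \<in> span H" unfolding span_breakdown_eq by blast
    moreover have "span H = H" using H(1) by simp
    ultimately have "x - scale k a \<in> X \<inter> H"
      using X(1) x a by (simp add: subspace_diff subspace_scale)
    then show "x \<in> span (insert a (X \<inter> H))"
      unfolding span_breakdown_eq using span_base by blast
  qed
  moreover have "X \<inter> H \<subseteq> span F" using F(2) X(2) by blast
  then obtain B where B: "B \<subseteq> X \<inter> H" "independent B" "X \<inter> H \<subseteq> span B"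
    "card B = dim (X \<inter> H)" "finite B"
    by (rule finite_basis_in_span[OF F(1)])
  moreover have "span (insert a (X \<inter> H)) \<subseteq> span (insert a B)"
    using B(3) span_mono[of B "insert a B"] span_base[of a "insert a B"]
    by (intro span_minimal subspace_span) blast
  ultimately have "dim X \<le> card (insert a B)" by (intro dim_le_card) auto
  also have "\<dots> \<le> Suc (card B)" using B(5) by (simp add: card_insert_if) 
  finally show ?thesis using B(4) by simp
qed

end

section \<open>Flats of an arrangement, their ranks and covers\<close>

locale finite_arrangement = finite_dimensional_vector_space scale Basis
  for scale :: "'k::field \<Rightarrow> 'u::ab_group_add \<Rightarrow> 'u" and Basis +
  fixes \<H> :: "('u \<Rightarrow> 'k) set set"
  assumes arrangement: "arrangement scale \<H>"
begin

interpretation dual: vector_space "pointwise (*) :: 'k \<Rightarrow> ('u \<Rightarrow> 'k) \<Rightarrow> _"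
  by unfold_locales (auto simp: pointwise_def fun_eq_iff algebra_simps)

abbreviation "L \<equiv> intersection_lattice scale \<H>"

lemma linear_dual: "f \<in> dual_space scale \<longleftrightarrow> (\<forall>u v. f (u + v) = f u + f v) \<and> (\<forall>c u. f (scale c u) = c * f u)"
proof -
  interpret k: vector_space "(*) :: 'k \<Rightarrow> 'k \<Rightarrow> 'k"
    by unfold_locales (simp_all add: algebra_simps)
  show ?thesis
    unfolding dual_space_def
    by (simp add: Vector_Spaces.linear_def module_hom_def module_hom_axioms_def
        k.vector_space_axioms vector_space_axioms k.module_axioms module_axioms)
qed

lemma subspace_dual_space: "dual.subspace (dual_space scale)"
  by (rule dual.subspaceI) (auto simp: linear_dual pointwise_def algebra_simps)

lemma dual_space_spanned: "\<exists>F. finite F \<and> dual_space scale \<subseteq> dual.span F"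
proof (intro exI conjI subsetI)
  \<comment> \<open>The coordinate functionals of \<open>Basis\<close>; a functional
    \<open>f\<close> is their combination with coefficients \<open>f b\<close>.\<close>
  let ?c = "\<lambda>b u. representation Basis u b"
  show "finite (?c ` Basis)" using finite_Basis by simp
  fix f assume f: "f \<in> dual_space scale"
  have eq: "f u = (\<Sum>b\<in>Basis. f b * representation Basis u b)" for u
  proof -
    have f': "f (\<Sum>b\<in>B. g b) = (\<Sum>b\<in>B. f (g b))" for g and B :: "'u set"
    proof (rule additive.sum)
      show "additive f" by (rule additive.intro) (use f in \<open>simp add: linear_dual\<close>)
    qed
    have "u = (\<Sum>b\<in>Basis. scale (representation Basis u b) b)"
      by (rule sum_representation_eq[symmetric])
        (use independent_Basis span_Basis finite_Basis in auto)
    then have "f u = f (\<Sum>b\<in>Basis. scale (representation Basis u b) b)" by simp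
    also have "\<dots> = (\<Sum>b\<in>Basis. f b * representation Basis u b)"
      using f by (simp add: f' linear_dual mult.commute)
    finally show ?thesis .
  qed
  have "f = (\<Sum>b\<in>Basis. pointwise (*) (f b) (?c b))"
    unfolding fun_eq_iff sum_fun_apply pointwise_def using eq by blast
  also have "\<dots> \<in> dual.span (?c ` Basis)"
    by (intro dual.span_sum dual.span_scale dual.span_base imageI)
  finally show "f \<in> dual.span (?c ` Basis)" .
qed

lemma flatE:
  assumes "X \<in> elts L"
  obtains \<A> where "\<A> \<subseteq> \<H>" "X = dual_space scale \<inter> \<Inter>\<A>"
  using assms by (auto simp: intersection_lattice_def)

lemma flat_subset: "X \<in> elts L \<Longrightarrow> X \<subseteq> dual_space scale"
  by (auto simp: intersection_lattice_def)

lemma flat_dual_space: "dual_space scale \<in> elts L"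
  by (auto simp: intersection_lattice_def intro!: exI[of _ "{}"])

lemma flat_Int:
  assumes "X \<in> elts L" "Y \<in> elts L" shows "X \<inter> Y \<in> elts L"
proof -
  obtain \<A> \<B> where "\<A> \<subseteq> \<H>" "X = dual_space scale \<inter> \<Inter>\<A>" "\<B> \<subseteq> \<H>" "Y = dual_space scale \<inter> \<Inter>\<B>"
    using flatE[OF assms(1)] flatE[OF assms(2)] by metis
  then have "X \<inter> Y = dual_space scale \<inter> \<Inter>(\<A> \<union> \<B>)" "\<A> \<union> \<B> \<subseteq> \<H>" by auto
  then show ?thesis
    unfolding intersection_lattice_def ranked_poset.simps mem_Collect_eq by blast
qed

lemma hyperplaneD:
  assumes "H \<in> \<H>"
  shows "H \<subseteq> dual_space scale" "dual.subspace H" "codim scale H = 1"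
  using arrangement assms by (auto simp: arrangement_def is_hyperplane_def)

lemma flat_hyperplane: "H \<in> \<H> \<Longrightarrow> H \<in> elts L"
  using hyperplaneD(1) unfolding intersection_lattice_def
  by (auto intro!: exI[of _ "{H}"])

lemma subspace_flat: "X \<in> elts L \<Longrightarrow> dual.subspace X"
proof (erule flatE)
  fix \<A> assume "\<A> \<subseteq> \<H>" "X = dual_space scale \<inter> \<Inter>\<A>"
  then show "dual.subspace X"
    using subspace_dual_space hyperplaneD(2)
    by (auto intro!: dual.subspace_inter dual.subspace_Inter)
qed

lemma rank_flat: "rk L X = dual_dim (dual_space scale) - dual_dim X"
  by (simp add: intersection_lattice_def codim_def)

lemma leq_flat: "leq L Y X \<longleftrightarrow> X \<subseteq> Y"
  by (simp add: intersection_lattice_def)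

lemma rank_strict_mono:
  assumes "X \<in> elts L" "Y \<in> elts L" "X \<subset> Y" shows "rk L Y < rk L X"
proof -
  obtain F where F: "finite F" "dual_space scale \<subseteq> dual.span F" using dual_space_spanned by blast
  have "dual_dim X < dual_dim Y"
    by (rule dual.dim_strict_mono_span[OF F(1)]) (use F assms flat_subset subspace_flat in auto)
  \<comment> \<open>The codimension is a truncated difference, so strictness survives only because
    the dimension of \<open>Y\<close> does not exceed that of the dual space.\<close>
  moreover have "dual_dim Y \<le> dual_dim (dual_space scale)"
    by (rule dual.dim_mono_span[OF F]) (use assms flat_subset in auto)
  ultimately show ?thesis unfolding rank_flat by simp
qed

lemma rank_Int_hyperplane:
  assumes "X \<in> elts L" "H \<in> \<H>" shows "rk L (X \<inter> H) \<le> Suc (rk L X)"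
proof -
  obtain F where F: "finite F" "dual_space scale \<subseteq> dual.span F" using dual_space_spanned by blast
  have "dual_dim X \<le> Suc (dual_dim (X \<inter> H))"
    by (rule dual.dim_Int_hyperplane[OF F])
      (use assms flat_subset subspace_flat hyperplaneD[OF assms(2)] subspace_dual_space
        in \<open>auto simp: codim_def\<close>)
  then show ?thesis unfolding rank_flat by simp
qed

text \<open>Some hyperplane containing \<open>X\<close> does not contain \<open>Y\<close>; it meets
  \<open>Y\<close> in a flat properly inside \<open>Y\<close>, which must be \<open>X\<close>. One
  hyperplane raises the rank by at most one, a proper inclusion by at least one.\<close>

lemma covered_flatD:
  assumes "covered_by L Y X"
  shows "\<exists>H\<in>\<H>. X = Y \<inter> H" "rk L X = Suc (rk L Y)"
proof -
  have YX: "Y \<in> elts L" "X \<in> elts L" "X \<subset> Y"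
    and between: "\<And>Z. Z \<in> elts L \<Longrightarrow> Z \<subseteq> Y \<Longrightarrow> X \<subseteq> Z \<Longrightarrow> Z = Y \<or> Z = X"
    using assms by (auto simp: covered_by_def leq_flat)
  obtain \<A> where \<A>: "\<A> \<subseteq> \<H>" "X = dual_space scale \<inter> \<Inter>\<A>" using YX(2) by (rule flatE)
  then obtain H where H: "H \<in> \<A>" "\<not> Y \<subseteq> H" using YX flat_subset[OF YX(1)] by blast
  then have HH: "H \<in> \<H>" using \<A> by blast
  have "Y \<inter> H = Y \<or> Y \<inter> H = X"
    by (rule between) (use YX \<A> H flat_Int flat_hyperplane[OF HH] in auto)
  then have X: "X = Y \<inter> H" using H by blast
  then show "\<exists>H\<in>\<H>. X = Y \<inter> H" using HH by blast
  show "rk L X = Suc (rk L Y)"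
    using rank_Int_hyperplane[OF YX(1) HH] rank_strict_mono[OF YX(2,1,3)] X by simp
qed

lemma flat_covered:
  assumes "Y \<in> elts L" "X \<in> elts L" "X \<subseteq> Y" "rk L X = Suc (rk L Y)"
  shows "covered_by L Y X"
proof -
  have "Z = Y \<or> Z = X" if "Z \<in> elts L" "Z \<subseteq> Y" "X \<subseteq> Z" for Z
    using rank_strict_mono[of Z Y] rank_strict_mono[of X Z] that assms by fastforce
  moreover have "Y \<noteq> X" using assms(4) by auto
  ultimately show ?thesis using assms by (auto simp: covered_by_def leq_flat)
qed

lemma finite_flats: "finite (elts L)"
proof -
  have "elts L = (\<lambda>\<A>. dual_space scale \<inter> \<Inter>\<A>) ` Pow \<H>"
    by (auto simp: intersection_lattice_def)
  then show ?thesis using arrangement by (simp add: arrangement_def)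
qed

lemma rank_dual_space: "rk L (dual_space scale) = 0"
  by (simp add: rank_flat)

lemma ranked_with_bottom_flats: "ranked_with_bottom L"
proof -
  have "X = dual_space scale" if "X \<in> elts L" "rk L X = 0" for X
    using rank_strict_mono[OF that(1) flat_dual_space] flat_subset[OF that(1)] that(2) by auto
  moreover have "\<exists>Y. covered_by L Y X" if "X \<in> elts L" "rk L X = 1" for X
    using flat_covered[OF flat_dual_space that(1) flat_subset[OF that(1)]] that(2) rank_dual_space
    by auto
  ultimately show ?thesis
    unfolding ranked_with_bottom_def using finite_flats covered_flatD(2) by metis
qed

text \<open>The common cover is \<open>X \<inter> Z\<close>. Writing \<open>Z = Y \<inter> H\<close>
  shows that it equals \<open>X \<inter> H\<close>, so its rank exceeds that of \<open>X\<close> by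
  exactly one.\<close>

lemma flats_semimodular:
  assumes "covered_by L Y X" "covered_by L Y Z" "X \<noteq> Z"
  shows "\<exists>T. covered_by L X T \<and> covered_by L Z T"
proof (intro exI conjI)
  have el: "X \<in> elts L" "Y \<in> elts L" "Z \<in> elts L" "X \<subseteq> Y"
    using assms by (auto simp: covered_by_def leq_flat)
  obtain H where H: "H \<in> \<H>" "Z = Y \<inter> H" using covered_flatD(1)[OF assms(2)] by blast
  have rk: "rk L X = rk L Z" using covered_flatD(2) assms(1,2) by metis
  have "X \<inter> Z = X \<inter> H" using H el by blast
  then have "rk L (X \<inter> Z) \<le> Suc (rk L X)" using rank_Int_hyperplane[OF el(1) H(1)] by simp
  moreover have "X \<inter> Z \<subset> X" using rank_strict_mono[OF el(1,3)] assms(3) rk by auto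
  then have "rk L X < rk L (X \<inter> Z)" using rank_strict_mono el flat_Int by metis
  ultimately have "rk L (X \<inter> Z) = Suc (rk L X)" by simp
  then show "covered_by L X (X \<inter> Z)" "covered_by L Z (X \<inter> Z)"
    using flat_covered el flat_Int rk by simp_all
qed

sublocale geometric_poset L
proof
  show "ranked_with_bottom L" by (rule ranked_with_bottom_flats)
  show "leq L X Z" if "leq L X Y" "leq L Y Z" for X Y Z
    using that by (auto simp: leq_flat)
  show "X = Y" if "X \<in> elts L" "Y \<in> elts L" "leq L X Y" "rk L X = rk L Y" for X Y
    using rank_strict_mono[of Y X] that by (auto simp: leq_flat)
  show "covered_by L Y X" if "Y \<in> elts L" "X \<in> elts L" "leq L Y X" "rk L X = Suc (rk L Y)" for X Y
    using that by (intro flat_covered) (simp_all add: leq_flat)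
  show "\<exists>T. covered_by L X T \<and> covered_by L Z T"
    if "covered_by L Y X" "covered_by L Y Z" "X \<noteq> Z" for X Y Z
    using that by (rule flats_semimodular)
  show "T = T'" if "covered_by L X T" "covered_by L X T'" "Y \<in> elts L" "leq L Y T" "leq L Y T'"
    "\<not> leq L Y X" for X Y T T'
  proof -
    \<comment> \<open>The flat \<open>X \<inter> Y\<close> lies between \<open>X\<close> and its
      cover \<open>S\<close> and differs from \<open>X\<close>.\<close>
    have "S = X \<inter> Y" if "covered_by L X S" "leq L Y S" for S
      using that flat_Int[of X Y] \<open>\<not> leq L Y X\<close> \<open>Y \<in> elts L\<close>
      unfolding covered_by_def leq_flat by blast
    then show ?thesis using that by metis
  qed
qed

end

section \<open>Derivations of the symmetric algebra\<close>

datatype 'a dual_number = Dual (std_part: 'a) (eps_part: 'a)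

instantiation dual_number :: (comm_ring_1) comm_ring_1
begin

definition zero_dual_number where "0 = Dual 0 0"
definition one_dual_number where "1 = Dual 1 0"
definition plus_dual_number where
  "a + b = Dual (std_part a + std_part b) (eps_part a + eps_part b)"
definition minus_dual_number where
  "a - b = Dual (std_part a - std_part b) (eps_part a - eps_part b)"
definition uminus_dual_number where "- a = Dual (- std_part a) (- eps_part a)"
definition times_dual_number where
  "a * b = Dual (std_part a * std_part b) (std_part a * eps_part b + std_part b * eps_part a)"

instance
  by standard
    (simp_all add: zero_dual_number_def one_dual_number_def plus_dual_number_def
      minus_dual_number_def uminus_dual_number_def times_dual_number_def algebra_simps
      dual_number.expand)

end

lemma dual_number_parts [simp]:
  "std_part 0 = 0" "eps_part 0 = 0" "std_part 1 = 1" "eps_part 1 = 0"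
  "std_part (a + b) = std_part a + std_part b" "eps_part (a + b) = eps_part a + eps_part b"
  "std_part (a * b) = std_part a * std_part b"
  "eps_part (a * b) = std_part a * eps_part b + std_part b * eps_part a"
  by (simp_all add: zero_dual_number_def one_dual_number_def plus_dual_number_def times_dual_number_def)

section \<open>Evaluation of polynomials as a ring homomorphism\<close>

definition eval_monom :: "('u \<Rightarrow> 's::comm_ring_1) \<Rightarrow> ('u \<Rightarrow>\<^sub>0 nat) \<Rightarrow> 's" where
  "eval_monom \<iota> m = (\<Prod>u\<in>Poly_Mapping.keys m. \<iota> u ^ Poly_Mapping.lookup m u)"

lemma eval_monom_superset:
  assumes "finite A" "Poly_Mapping.keys m \<subseteq> A"
  shows "eval_monom \<iota> m = (\<Prod>u\<in>A. \<iota> u ^ Poly_Mapping.lookup m u)"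
  unfolding eval_monom_def
  by (rule prod.mono_neutral_left) (use assms in \<open>auto simp: in_keys_iff\<close>)

lemma eval_monom_add: "eval_monom \<iota> (m + n) = eval_monom \<iota> m * eval_monom \<iota> n"
proof -
  let ?A = "Poly_Mapping.keys m \<union> Poly_Mapping.keys n"
  show ?thesis
    by (subst (1 2 3) eval_monom_superset[where A = ?A])
      (auto simp: lookup_add power_add prod.distrib dest: set_mp[OF Poly_Mapping.keys_add])
qed

lemma is_ring_hom_0: "is_ring_hom f \<Longrightarrow> f 0 = 0"
  unfolding is_ring_hom_def by (metis add.right_neutral add_left_cancel)

context
  fixes \<kappa> :: "'k::comm_ring_1 \<Rightarrow> 's::comm_ring_1" and \<iota> :: "'u \<Rightarrow> 's"
  assumes hom: "is_ring_hom \<kappa>"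
begin

lemma eval_mpoly_superset:
  assumes "finite A" "Poly_Mapping.keys p \<subseteq> A"
  shows "eval_mpoly \<kappa> \<iota> p = (\<Sum>m\<in>A. \<kappa> (Poly_Mapping.lookup p m) * eval_monom \<iota> m)"
  unfolding eval_mpoly_def eval_monom_def[symmetric]
  by (rule sum.mono_neutral_left)
    (use assms is_ring_hom_0[OF hom] in \<open>auto simp: in_keys_iff\<close>)

lemma eval_mpoly_add: "eval_mpoly \<kappa> \<iota> (p + q) = eval_mpoly \<kappa> \<iota> p + eval_mpoly \<kappa> \<iota> q"
proof -
  let ?A = "Poly_Mapping.keys p \<union> Poly_Mapping.keys q"
  have "\<kappa> (a + b) = \<kappa> a + \<kappa> b" for a b using hom by (simp add: is_ring_hom_def)
  then show ?thesis
    by (subst (1 2 3) eval_mpoly_superset[where A = ?A])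
      (auto simp: lookup_add distrib_right sum.distrib dest: set_mp[OF Poly_Mapping.keys_add])
qed

lemma eval_mpoly_0 [simp]: "eval_mpoly \<kappa> \<iota> 0 = 0"
  by (simp add: eval_mpoly_def)

lemma eval_mpoly_sum: "eval_mpoly \<kappa> \<iota> (\<Sum>i\<in>I. p i) = (\<Sum>i\<in>I. eval_mpoly \<kappa> \<iota> (p i))"
  by (induction I rule: infinite_finite_induct) (simp_all add: eval_mpoly_add)

lemma eval_mpoly_single: "eval_mpoly \<kappa> \<iota> (Poly_Mapping.single m c) = \<kappa> c * eval_monom \<iota> m"
  by (subst eval_mpoly_superset[where A = "{m}"]) simp_all

lemma sum_single_lookup: "(\<Sum>m\<in>Poly_Mapping.keys p. Poly_Mapping.single m (Poly_Mapping.lookup p m)) = p"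
  by (rule poly_mapping_eqI) (simp add: lookup_sum lookup_single when_def in_keys_iff)

lemma eval_mpoly_mult: "eval_mpoly \<kappa> \<iota> (p * q) = eval_mpoly \<kappa> \<iota> p * eval_mpoly \<kappa> \<iota> q"
proof -
  have mult: "\<kappa> (a * b) = \<kappa> a * \<kappa> b" for a b using hom by (simp add: is_ring_hom_def)
  let ?s = "\<lambda>p m. Poly_Mapping.single m (Poly_Mapping.lookup p m)"
  have "p * q = (\<Sum>m\<in>Poly_Mapping.keys p. ?s p m) * (\<Sum>n\<in>Poly_Mapping.keys q. ?s q n)"
    by (simp add: sum_single_lookup)
  also have "\<dots> = (\<Sum>m\<in>Poly_Mapping.keys p. \<Sum>n\<in>Poly_Mapping.keys q. ?s p m * ?s q n)"
    by (rule sum_product)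
  also have "eval_mpoly \<kappa> \<iota> \<dots> = (\<Sum>m\<in>Poly_Mapping.keys p. \<Sum>n\<in>Poly_Mapping.keys q.
      eval_mpoly \<kappa> \<iota> (?s p m) * eval_mpoly \<kappa> \<iota> (?s q n))"
    unfolding eval_mpoly_sum mult_single eval_mpoly_single mult eval_monom_add
    by (simp only: ac_simps)
  also have "\<dots> = eval_mpoly \<kappa> \<iota> (\<Sum>m\<in>Poly_Mapping.keys p. ?s p m) *
      eval_mpoly \<kappa> \<iota> (\<Sum>n\<in>Poly_Mapping.keys q. ?s q n)"
    unfolding eval_mpoly_sum by (rule sum_product[symmetric])
  finally show ?thesis by (simp add: sum_single_lookup)
qed

lemma eval_mpoly_const: "eval_mpoly \<kappa> \<iota> (const c) = \<kappa> c"
  unfolding const_def eval_mpoly_single by (simp add: eval_monom_def)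

lemma eval_mpoly_var: "eval_mpoly \<kappa> \<iota> (var u) = \<iota> u"
  using hom unfolding var_def eval_mpoly_single by (simp add: eval_monom_def is_ring_hom_def)

lemma eval_mpoly_diff: "eval_mpoly \<kappa> \<iota> (p - q) = eval_mpoly \<kappa> \<iota> p - eval_mpoly \<kappa> \<iota> q"
  using eval_mpoly_add[of "p - q" q] by simp

lemma eval_mpoly_eq_0_ideal_gen:
  assumes "\<And>r. r \<in> R \<Longrightarrow> eval_mpoly \<kappa> \<iota> r = 0" "p \<in> ideal_gen R"
  shows "eval_mpoly \<kappa> \<iota> p = 0"
proof -
  interpret module "(*) :: ('u, 'k) mpoly \<Rightarrow> _"
    by unfold_locales (simp_all add: algebra_simps)
  show ?thesis
    using assms(2) unfolding ideal_gen_def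
    by (induction rule: span_induct_alt) (simp_all add: eval_mpoly_add eval_mpoly_mult assms(1))
qed

lemma eval_mpoly_induct:
  assumes "\<And>c. P (\<kappa> c)" "\<And>u. P (\<iota> u)" "\<And>a b. P a \<Longrightarrow> P b \<Longrightarrow> P (a + b)"
    "\<And>a b. P a \<Longrightarrow> P b \<Longrightarrow> P (a * b)"
  shows "P (eval_mpoly \<kappa> \<iota> p)"
proof -
  \<comment> \<open>Empty sums and products are values of \<open>\<kappa>\<close>, so the hypothesis
    on constants covers them.\<close>
  have P0: "P 0" using assms(1)[of 0] is_ring_hom_0[OF hom] by simp
  have P1: "P 1" using assms(1)[of 1] hom by (simp add: is_ring_hom_def)
  have power: "P (a ^ n)" if "P a" for a n
    by (induction n) (simp_all add: P1 assms(4) that)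
  have prod: "P (\<Prod>i\<in>I. f i)" if "\<And>i. P (f i)" for f and I :: "'u set"
    by (induction I rule: infinite_finite_induct) (simp_all add: P1 assms(4) that)
  have sum: "P (\<Sum>i\<in>I. f i)" if "\<And>i. P (f i)" for f and I :: "('u \<Rightarrow>\<^sub>0 nat) set"
    by (induction I rule: infinite_finite_induct) (simp_all add: P0 assms(3) that)
  show ?thesis unfolding eval_mpoly_def by (intro sum assms(4) assms(1) prod power assms(2))
qed

end

section \<open>Extending linear maps to derivations\<close>

locale symmetric_algebra =
  fixes scale :: "'k::comm_ring_1 \<Rightarrow> 'u::ab_group_add \<Rightarrow> 'u"
    and \<kappa> :: "'k \<Rightarrow> 's::comm_ring_1" and \<iota> :: "'u \<Rightarrow> 's"
  assumes symmetric_algebra: "is_symmetric_algebra scale \<kappa> \<iota>"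
begin

lemma hom: "is_ring_hom \<kappa>"
  using symmetric_algebra by (simp add: is_symmetric_algebra_def)

lemma kappa_simps [simp]: "\<kappa> 0 = 0" "\<kappa> 1 = 1" "\<kappa> (a + b) = \<kappa> a + \<kappa> b" "\<kappa> (a * b) = \<kappa> a * \<kappa> b"
  using hom is_ring_hom_0[OF hom] by (simp_all add: is_ring_hom_def)

lemma surj_eval: "\<exists>p. x = eval_mpoly \<kappa> \<iota> p"
  using symmetric_algebra by (auto simp: is_symmetric_algebra_def)

lemma eval_eq_0_iff: "eval_mpoly \<kappa> \<iota> p = 0 \<longleftrightarrow> p \<in> ideal_gen (linear_relations scale)"
  using symmetric_algebra by (auto simp: is_symmetric_algebra_def)

lemma linear_relation_eval:
  assumes "r \<in> linear_relations scale" shows "eval_mpoly \<kappa> \<iota> r = 0"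
proof -
  interpret module "(*) :: ('u, 'k) mpoly \<Rightarrow> _"
    by unfold_locales (simp_all add: algebra_simps)
  show ?thesis using assms span_base unfolding eval_eq_0_iff ideal_gen_def by blast
qed

lemma iota_add: "\<iota> (u + v) = \<iota> u + \<iota> v"
proof -
  have "var (u + v) - var u - var v \<in> linear_relations scale" unfolding linear_relations_def by blast
  from linear_relation_eval[OF this] have "\<iota> (u + v) - \<iota> u - \<iota> v = 0"
    by (simp add: eval_mpoly_diff[OF hom] eval_mpoly_var[OF hom])
  then show ?thesis by (simp add: algebra_simps)
qed

lemma iota_scale: "\<iota> (scale c u) = \<kappa> c * \<iota> u"
proof -
  have "var (scale c u) - const c * var u \<in> linear_relations scale"
    unfolding linear_relations_def by blast
  from linear_relation_eval[OF this] show ?thesis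
    by (simp add: eval_mpoly_diff[OF hom] eval_mpoly_mult[OF hom] eval_mpoly_var[OF hom]
        eval_mpoly_const[OF hom])
qed

lemma additive_iota: "additive \<iota>"
  by (rule additive.intro) (rule iota_add)

lemma symmetric_algebra_induct:
  assumes "\<And>c. P (\<kappa> c)" "\<And>u. P (\<iota> u)" "\<And>a b. P a \<Longrightarrow> P b \<Longrightarrow> P (a + b)"
    "\<And>a b. P a \<Longrightarrow> P b \<Longrightarrow> P (a * b)"
  shows "P x"
  using eval_mpoly_induct[OF hom, of P \<iota>] assms surj_eval[of x] by metis

definition derivation :: "('s \<Rightarrow> 's) \<Rightarrow> bool" where
  "derivation D \<longleftrightarrow> additive D \<and> (\<forall>f g. D (f * g) = f * D g + g * D f) \<and> (\<forall>c. D (\<kappa> c) = 0)"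

text \<open>
  A derivation \<open>D\<close> is the same as an algebra homomorphism \<open>f \<mapsto> f + D f \<epsilon>\<close> to the dual numbers,
  so it can be prescribed on \<open>U\<close>.
\<close>

lemma derivation_exists:
  assumes add: "\<And>u v. \<delta> (u + v) = \<delta> u + \<delta> v" and scale: "\<And>c u. \<delta> (scale c u) = scale c (\<delta> u)"
  shows "\<exists>D. derivation D \<and> (\<forall>u. D (\<iota> u) = \<iota> (\<delta> u))"
proof -
  let ?k = "\<lambda>c. Dual (\<kappa> c) 0" and ?i = "\<lambda>u. Dual (\<iota> u) (\<iota> (\<delta> u))"
  have k: "is_ring_hom ?k"
    by (simp add: is_ring_hom_def one_dual_number_def plus_dual_number_def times_dual_number_def)
  let ?\<Phi> = "eval_mpoly ?k ?i"
  note eval_simps = eval_mpoly_add eval_mpoly_diff eval_mpoly_mult eval_mpoly_var eval_mpoly_const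
  have "?\<Phi> r = 0" if "r \<in> linear_relations scale" for r
    using that unfolding linear_relations_def
    by (auto simp: eval_simps[OF k] add scale iota_add iota_scale minus_dual_number_def
        times_dual_number_def zero_dual_number_def)
  then have "?\<Phi> p = 0" if "eval_mpoly \<kappa> \<iota> p = 0" for p
    using eval_mpoly_eq_0_ideal_gen[OF k] that unfolding eval_eq_0_iff by blast
  \<comment> \<open>Well-definedness: the kernel of evaluation is generated by the linear relations,
    which \<open>?\<Phi>\<close> also kills, so \<open>?\<Phi> p\<close> depends only on the element
    that \<open>p\<close> represents.\<close>
  then have cong: "?\<Phi> p = ?\<Phi> q" if "eval_mpoly \<kappa> \<iota> p = eval_mpoly \<kappa> \<iota> q" for p q
    using that eval_mpoly_diff[OF hom, of \<iota> p q] eval_mpoly_diff[OF k, of ?i p q] by simp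
  \<comment> \<open>The standard part is the element itself, which turns the product of dual numbers
    into the Leibniz rule for the \<epsilon>-part.\<close>
  have std: "std_part (?\<Phi> p) = eval_mpoly \<kappa> \<iota> p" for p
  proof -
    have sum: "std_part (\<Sum>i\<in>I. f i) = (\<Sum>i\<in>I. std_part (f i))" for f :: "_ \<Rightarrow> 's dual_number" and I
      by (induction I rule: infinite_finite_induct) simp_all
    have prod: "std_part (\<Prod>i\<in>I. f i) = (\<Prod>i\<in>I. std_part (f i))" for f :: "_ \<Rightarrow> 's dual_number" and I
      by (induction I rule: infinite_finite_induct) simp_all
    have power: "std_part (a ^ n) = std_part a ^ n" for a :: "'s dual_number" and n
      by (induction n) simp_all
    show ?thesis unfolding eval_mpoly_def by (simp add: sum prod power)
  qed
  define D where "D x = eps_part (?\<Phi> (SOME p. x = eval_mpoly \<kappa> \<iota> p))" for x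
  have D: "D (eval_mpoly \<kappa> \<iota> p) = eps_part (?\<Phi> p)" for p
    unfolding D_def by (metis (mono_tags, lifting) cong someI)
  have "D (f + g) = D f + D g" for f g
  proof -
    obtain p q where pq: "f = eval_mpoly \<kappa> \<iota> p" "g = eval_mpoly \<kappa> \<iota> q" using surj_eval by metis
    show ?thesis
      unfolding pq eval_mpoly_add[OF hom, symmetric] D eval_mpoly_add[OF k] by simp
  qed
  moreover have "D (f * g) = f * D g + g * D f" for f g
  proof -
    obtain p q where pq: "f = eval_mpoly \<kappa> \<iota> p" "g = eval_mpoly \<kappa> \<iota> q" using surj_eval by metis
    show ?thesis
      unfolding pq eval_mpoly_mult[OF hom, symmetric] D eval_mpoly_mult[OF k] by (simp add: std)
  qed
  moreover have "D (\<kappa> c) = 0" for c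
    using D[of "const c"] by (simp add: eval_mpoly_const[OF hom] eval_mpoly_const[OF k])
  moreover have "D (\<iota> u) = \<iota> (\<delta> u)" for u
    using D[of "var u"] by (simp add: eval_mpoly_var[OF hom] eval_mpoly_var[OF k])
  ultimately show ?thesis unfolding derivation_def by (auto intro: additive.intro)
qed

end

section \<open>Sums of eigenvectors with natural eigenvalues at least \<open>m\<close>\<close>

inductive_set eigensum :: "('s \<Rightarrow> 's) \<Rightarrow> nat \<Rightarrow> 's::comm_ring_1 set" for E m where
  zero: "0 \<in> eigensum E m"
| add: "E f = of_nat k * f \<Longrightarrow> m \<le> k \<Longrightarrow> g \<in> eigensum E m \<Longrightarrow> f + g \<in> eigensum E m"

lemma eigensum_add: "f \<in> eigensum E m \<Longrightarrow> g \<in> eigensum E m \<Longrightarrow> f + g \<in> eigensum E m"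
  by (induction rule: eigensum.induct) (auto simp: add.assoc intro: eigensum.add)

lemma eigensumI: "E f = of_nat k * f \<Longrightarrow> m \<le> k \<Longrightarrow> f \<in> eigensum E m"
  using eigensum.add[of E f k m 0] eigensum.zero[of E m] by simp

text \<open>By the Leibniz rule, eigenvalues add under multiplication.\<close>

lemma eigensum_mult:
  assumes leibniz: "\<And>f g. E (f * g) = f * E g + g * E f"
    and "f \<in> eigensum E m" "g \<in> eigensum E n"
  shows "f * g \<in> eigensum E (m + n)"
  using assms(2)
proof (induction rule: eigensum.induct)
  case (add f k f')
  have "f * g \<in> eigensum E (m + n)"
    using assms(3)
  proof (induction rule: eigensum.induct)
    case (add g l g')
    have "E (f * g) = of_nat (k + l) * (f * g)"
      using add.hyps(1) \<open>E f = of_nat k * f\<close> by (simp add: leibniz algebra_simps)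
    then have "f * g \<in> eigensum E (m + n)"
      by (rule eigensumI) (use add.hyps \<open>m \<le> k\<close> in simp)
    then show ?case using add.IH by (simp add: distrib_left eigensum_add)
  qed (simp add: eigensum.zero)
  then show ?case using add.IH by (simp add: distrib_right eigensum_add)
qed (simp add: eigensum.zero)

text \<open>An eigenvector with eigenvalue \<open>k\<close> is killed by the factor
  \<open>E - k\<close>, which is present because \<open>k\<close> is at least 1. For a sum, the
  larger of the two bounds serves.\<close>

lemma shifted_prod_eigensum:
  assumes "additive E" "f \<in> eigensum E 1"
  shows "\<exists>N. shifted_prod E N f = 0"
  using assms(2)
proof (induction rule: eigensum.induct)
  case zero
  have "shifted_prod E 0 0 = 0" by simp
  then show ?case by blast
next
  case (add f k g)
  then obtain N l where N: "shifted_prod E N g = 0" and l: "k = Suc l" by (cases k) auto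
  have "shifted_prod E k f = 0"
    using add.hyps(1) additive.zero[OF additive_shifted_prod[OF assms(1)]] by (simp add: l)
  then have "shifted_prod E (max k N) f = 0" "shifted_prod E (max k N) g = 0"
    using N shifted_prod_mono[OF assms(1)] by (metis max.cobounded1, metis max.cobounded2)
  then have "shifted_prod E (max k N) (f + g) = 0"
    by (simp add: additive.add[OF additive_shifted_prod[OF assms(1)]])
  then show ?case by blast
qed

section \<open>Ideals and their behaviour under derivations\<close>

interpretation ring: module "(*) :: 's::comm_ring_1 \<Rightarrow> _"
  by unfold_locales (simp_all add: algebra_simps)

lemma ideal_gen_induct [consumes 1, case_names zero step]:
  assumes "f \<in> ideal_gen A" "P 0" "\<And>a r g. a \<in> A \<Longrightarrow> P g \<Longrightarrow> P (r * a + g)"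
  shows "P f"
  using assms unfolding ideal_gen_def by (rule ring.span_induct_alt)

lemma subspace_ideal_gen: "ring.subspace (ideal_gen A)"
  unfolding ideal_gen_def by (rule ring.subspace_span)

lemma ideal_gen_base: "a \<in> A \<Longrightarrow> a \<in> ideal_gen A"
  unfolding ideal_gen_def by (rule ring.span_base)

lemmas ideal_gen_0 = ring.subspace_0[OF subspace_ideal_gen]
  and ideal_gen_add = ring.subspace_add[OF subspace_ideal_gen]
  and ideal_gen_diff = ring.subspace_diff[OF subspace_ideal_gen]
  and ideal_gen_mult = ring.subspace_scale[OF subspace_ideal_gen]

lemma ideal_gen_mult_right: "a \<in> ideal_gen A \<Longrightarrow> a * r \<in> ideal_gen A"
  using ideal_gen_mult[of a A r] by (simp add: mult.commute)

context symmetric_algebra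
begin

lemma derivationD:
  assumes "derivation D"
  shows "additive D" "D (f * g) = f * D g + g * D f" "D (\<kappa> c) = 0"
    "D 0 = 0" "D (f + g) = D f + D g"
  using assms additive.zero[of D] additive.add[of D] by (auto simp: derivation_def)

lemma derivation_sum:
  assumes "\<And>i. i \<in> I \<Longrightarrow> derivation (D i)"
  shows "derivation (\<lambda>f. \<Sum>i\<in>I. D i f)"
  using assms unfolding derivation_def
  by (auto simp: additive_def sum.distrib sum_distrib_left)

lemma derivation_in_ideal:
  assumes D: "derivation D" and "\<And>u. D (\<iota> u) \<in> ideal_gen A"
  shows "D f \<in> ideal_gen A"
  by (induction f rule: symmetric_algebra_induct)
    (simp_all add: derivationD[OF D] assms(2) ideal_gen_0 ideal_gen_add ideal_gen_mult)

lemma derivation_preserves_ideal: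
  assumes D: "derivation D" and "\<And>a. a \<in> A \<Longrightarrow> D a \<in> ideal_gen A" and "f \<in> ideal_gen A"
  shows "D f \<in> ideal_gen A"
  using assms(3)
  by (induction rule: ideal_gen_induct)
    (simp_all add: derivationD[OF D] assms(2) ideal_gen_0 ideal_gen_add ideal_gen_mult
      ideal_gen_mult_right ideal_gen_base)

text \<open>Splitting \<open>u\<close> into \<open>T u\<close> and \<open>u - T u\<close> gives
  eigenvectors of eigenvalues 1 and 0, so all of the algebra consists of sums of eigenvectors with
  natural eigenvalues. Generators of the ideal are fixed by \<open>T\<close>, and multiplying by
  them raises each eigenvalue by one, hence makes it positive.\<close>

lemma shifted_prod_ideal:
  assumes D: "derivation D" and T: "\<And>u. D (\<iota> u) = \<iota> (T u)" "\<And>u. T (T u) = T u"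
    and M: "\<And>u. u \<in> M \<Longrightarrow> T u = u" and f: "f \<in> ideal_gen (\<iota> ` M)"
  shows "\<exists>N. shifted_prod D N f = 0"
proof (rule shifted_prod_eigensum[OF derivationD(1)[OF D]])
  have all: "g \<in> eigensum D 0" for g
  proof (induction g rule: symmetric_algebra_induct)
    case (1 c)
    show ?case by (rule eigensumI[where k = 0]) (simp_all add: derivationD[OF D])
  next
    case (2 u)
    have "\<iota> (T u) \<in> eigensum D 0" by (rule eigensumI[where k = 1]) (simp_all add: T)
    moreover have "D (\<iota> (u - T u)) = 0"
      using additive.diff[OF derivationD(1)[OF D]] by (simp add: additive.diff[OF additive_iota] T)
    then have "\<iota> (u - T u) \<in> eigensum D 0" by (intro eigensumI[where k = 0]) simp_all
    ultimately have "\<iota> (T u) + \<iota> (u - T u) \<in> eigensum D 0" by (rule eigensum_add)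
    then show ?case by (simp add: additive.diff[OF additive_iota])
  next
    case (4 a b)
    then show ?case using eigensum_mult[OF derivationD(2)[OF D], of a 0 b 0] by simp
  qed (rule eigensum_add)
  show "f \<in> eigensum D 1"
    using f
  proof (induction rule: ideal_gen_induct)
    case (step a r g)
    then have "a \<in> eigensum D 1" by (intro eigensumI[where k = 1]) (auto simp: T M)
    from eigensum_mult[OF derivationD(2)[OF D] all this, of r]
    have "r * a \<in> eigensum D 1" by simp
    then show ?case using step(2) by (rule eigensum_add)
  qed (rule eigensum.zero)
qed

lemma kappa_of_nat: "\<kappa> (of_nat n) = of_nat n"
  by (induction n) simp_all

lemma nat_unit:
  assumes "c * of_nat n = (1 :: 'k)"
  shows "\<kappa> c * of_nat n = 1"
  using arg_cong[OF assms, of \<kappa>] by (simp add: kappa_of_nat)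

end

section \<open>From the relation complex to the defining ideals\<close>

context geometric_poset
begin

lemma euler_maps_of_homotopy:
  fixes scale :: "'k::field \<Rightarrow> 'u::ab_group_add \<Rightarrow> 'u" and N :: "'l \<Rightarrow> 'u set"
  assumes vs: "vector_space scale" and N: "\<And>x. x \<in> elts L \<Longrightarrow> module.subspace scale (N x)"
    and d: "is_homotopy (pointwise scale) L (minimal_complex L UNIV N) d" and rank: "total_rank L \<ge> 1"
  obtains \<delta> :: "'l \<Rightarrow> 'u \<Rightarrow> 'u" and T where
    "\<forall>a u v. \<delta> a (u + v) = \<delta> a u + \<delta> a v" "\<forall>a c u. \<delta> a (scale c u) = scale c (\<delta> a u)"
    "\<forall>a u. a \<in> elts L \<longrightarrow> rk L a = 1 \<longrightarrow> \<delta> a u \<in> N a"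
    "\<forall>u. (\<Sum>a | a \<in> elts L \<and> rk L a = 1. \<delta> a u) = T u" "\<forall>u. T (T u) = T u"
    "\<forall>a u. a \<in> elts L \<longrightarrow> rk L a = 1 \<longrightarrow> u \<in> N a \<longrightarrow> T u = u"
    "\<forall>x t u. x \<in> elts L \<longrightarrow> rk L x = 1 \<longrightarrow> covered_by L x t \<longrightarrow> u \<in> N x \<longrightarrow>
      (\<Sum>z | covered_by L z t \<and> z \<noteq> x. \<delta> z u) \<in> N x"
proof -
  interpret vector_space scale by (rule vs)
  interpret vector_space_pair scale scale ..
  interpret P: module "pointwise scale :: 'k \<Rightarrow> ('l list \<Rightarrow> 'u) \<Rightarrow> _"
    by (rule module_pointwise) (rule module_axioms)
  let ?V = "minimal_complex L UNIV N"
  let ?C = "chain_module L ?V"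
  let ?D = "chain_diff L :: ('l list \<Rightarrow> 'u) \<Rightarrow> _"
  let ?A = "{a. a \<in> elts L \<and> rk L a = 1}"
  have diff: "diff ?V i = ?D" for i by (simp add: minimal_complex_def)
  have graded: "compatibly_graded (pointwise scale) L ?V"
    by (rule minimal_complex_compatibly_graded) (use module_axioms ranked N in auto)
  have subC: "P.subspace (?C i)" for i
    unfolding chain_module_def
    by (rule subspace_sum_sub) (use graded P.module_axioms in \<open>auto simp: compatibly_graded_def\<close>)
  have C1: "w \<in> ?C 1 \<longleftrightarrow> w [] = 0 \<and> (\<forall>x\<in>?A. tail x w \<in> at_nil ` N x) \<and> (\<forall>x. x \<notin> ?A \<longrightarrow> tail x w = 0)" for w
    unfolding One_nat_def chain_module_minimal_complex by (subst sum_sub_prepend_iff) simp_all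
  have C2: "tail t w \<in> cycles L N 1 t \<or> tail t w = 0" if "w \<in> ?C 2" for t w
    using that unfolding numeral_2_eq_2 chain_module_minimal_complex
    by (subst (asm) sum_sub_prepend_iff) (simp, metis One_nat_def mem_Collect_eq)
  have dd: "?D (?D w) = 0" if "w \<in> ?C 2" for w
  proof -
    have "?D (tail t w) = 0" for t
      using C2[OF that, of t] cycles_Suc_iff[of "tail t w" N 0 t] chain_diff_0
      by (metis One_nat_def)
    then show ?thesis unfolding chain_diff_tail[of L w] chain_diff_sum by (intro sum.neutral) blast
  qed
  have d0: "linear_between (pointwise scale) (?D ` ?C 1) (?C 1) (d 0)"
    and d1: "\<And>w. w \<in> ?C 1 \<Longrightarrow> d 1 w \<in> ?C 2"
    and homotopy: "\<And>w. w \<in> ?C 1 \<Longrightarrow> d 0 (?D w) + ?D (d 1 w) = w"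
    and d1_cov: "\<And>x w. x \<in> ?A \<Longrightarrow> w \<in> component ?V x \<Longrightarrow> d 1 w \<in> sum_sub (component ?V) {y. x \<prec> y}"
  proof -
    have 1: "1 \<in> {1..total_rank L}" using rank by simp
    show "linear_between (pointwise scale) (?D ` ?C 1) (?C 1) (d 0)"
      using d unfolding is_homotopy_def diff by blast
    have "linear_between (pointwise scale) (?C 1) (?C (1 + 1)) (d 1)"
      using d 1 unfolding is_homotopy_def by blast
    then show "w \<in> ?C 1 \<Longrightarrow> d 1 w \<in> ?C 2" for w
      unfolding linear_between_def one_add_one by blast
    have "\<forall>w\<in>?C 1. d (1 - 1) (?D w) + ?D (d 1 w) = w"
      using d 1 unfolding is_homotopy_def diff by blast
    then show "w \<in> ?C 1 \<Longrightarrow> d 0 (?D w) + ?D (d 1 w) = w" for w by simp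
    show "d 1 w \<in> sum_sub (component ?V) {y. x \<prec> y}" if "x \<in> ?A" "w \<in> component ?V x" for x w
    proof -
      have "x \<in> elts L" "rk L x \<noteq> 0" "rk L x = 1" using that by auto
      then have "d (rk L x) ` component ?V x \<subseteq> sum_sub (component ?V) {y. x \<prec> y}"
        using d unfolding is_homotopy_def by blast
      then show ?thesis using that by auto
    qed
  qed
  \<comment> \<open>The image of the first differential, viewed as a subspace of
    \<open>'u\<close>.\<close>
  define M where "M = {u. at_nil u \<in> ?D ` ?C 1}"
  have subB: "P.subspace (?D ` ?C 1)"
    by (rule subspace_image[OF P.module_axioms P.module_axioms subC])
      (simp_all only: chain_diff_0 linear_chain_diff module_axioms)
  have "subspace M"
  proof (rule subspaceI)
    show "0 \<in> M" unfolding M_def using P.subspace_0[OF subB] by (simp only: mem_Collect_eq at_nil_0)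
    show "u + v \<in> M" if "u \<in> M" "v \<in> M" for u v
      using that P.subspace_add[OF subB] unfolding M_def by (simp only: mem_Collect_eq at_nil_add)
    show "scale c u \<in> M" if "u \<in> M" for c u
      using that P.subspace_scale[OF subB] unfolding M_def
      by (simp only: mem_Collect_eq at_nil_scale[OF module_axioms])
  qed
  \<comment> \<open>Over a field \<open>M\<close> has a complement, so there is a linear projection
    \<open>p\<close> onto it. It plays the role of \<open>T\<close>.\<close>
  then obtain p where p: "range p \<subseteq> M" "Vector_Spaces.linear scale scale p" "\<And>u. u \<in> M \<Longrightarrow> p u = u"
    using linear_exists_left_inverse_on[OF linear_id, of M] by (auto simp: inj_on_def)
  have pM: "at_nil (p u) \<in> ?D ` ?C 1" for u
  proof -
    have "p u \<in> M" by (rule subsetD[OF p(1)]) (rule rangeI)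
    then show ?thesis by (simp only: M_def mem_Collect_eq)
  qed
  \<comment> \<open>The homotopy gives control of \<open>d 0\<close> on the image of the first
    differential, so its argument is first projected there.\<close>
  define \<delta> where "\<delta> a u = d 0 (at_nil (p u)) [a]" for a u
  have d0p: "d 0 (at_nil (p u)) \<in> ?C 1" for u
    by (rule d0[unfolded linear_between_def, THEN conjunct1, rule_format, OF pM])
  have tail_d0: "tail a (d 0 (at_nil (p u))) = at_nil (\<delta> a u)" "a \<in> ?A \<Longrightarrow> \<delta> a u \<in> N a"
    "a \<notin> ?A \<Longrightarrow> \<delta> a u = 0" for a u
  proof -
    let ?w = "tail a (d 0 (at_nil (p u)))"
    have w: "?w [] = \<delta> a u" by (simp add: \<delta>_def tail_apply)
    have *: "a \<in> ?A \<Longrightarrow> ?w \<in> at_nil ` N a" "a \<notin> ?A \<Longrightarrow> ?w = 0"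
      using d0p[of u] unfolding C1 by blast+
    then show "a \<notin> ?A \<Longrightarrow> \<delta> a u = 0" using w by simp
    then show "?w = at_nil (\<delta> a u)"
      using * w at_nil_0 by (cases "a \<in> ?A") (auto simp del: mem_Collect_eq)
    show "a \<in> ?A \<Longrightarrow> \<delta> a u \<in> N a" using *(1) w by (auto simp del: mem_Collect_eq)
  qed
  \<comment> \<open>Applying \<partial> to the homotopy identity and using \<partial>\<partial> = 0
    shows that \<open>d 0\<close> is a section of the first differential over its image.\<close>
  have T: "(\<Sum>a\<in>?A. \<delta> a u) = p u" for u
  proof -
    obtain w where w: "w \<in> ?C 1" "at_nil (p u) = ?D w" using pM[of u] by blast
    have "?D (d 0 (at_nil (p u)) + ?D (d 1 w)) = ?D w"
      unfolding w(2) using homotopy[OF w(1)] by simp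
    then have "?D (d 0 (at_nil (p u))) = at_nil (p u)"
      unfolding linear_chain_diff(1) dd[OF d1[OF w(1)]] w(2) by simp
    then have "?D (d 0 (at_nil (p u))) [] = p u" by simp
    moreover have "?D (d 0 (at_nil (p u))) [] = (\<Sum>a\<in>elts L. \<delta> a u)"
      unfolding chain_diff_tail sum_fun_apply tail_d0(1) by simp
    moreover have "(\<Sum>a\<in>elts L. \<delta> a u) = (\<Sum>a\<in>?A. \<delta> a u)"
      by (rule sum.mono_neutral_right) (use tail_d0(3) finite_elts in auto)
    ultimately show ?thesis by simp
  qed
  have prepend_C1: "prepend x (at_nil u) \<in> ?C 1" if "x \<in> ?A" "u \<in> N x" for x u
  proof -
    have "0 \<in> at_nil ` N y" if "y \<in> ?A" for y
    proof -
      have "at_nil 0 \<in> at_nil ` N y" using subspace_0[OF N, of y] that by blast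
      then show ?thesis by (simp only: at_nil_0)
    qed
    then show ?thesis using that unfolding C1 by auto
  qed
  have NM: "u \<in> M" if "x \<in> ?A" "u \<in> N x" for x u
  proof -
    have "at_nil u = ?D (prepend x (at_nil u))"
      by (rule chain_diff_prepend[symmetric]) (use finite_elts that in auto)
    then show ?thesis unfolding M_def using prepend_C1[OF that] by blast
  qed
  have part: "(\<Sum>z | z \<prec> t \<and> z \<noteq> x. \<delta> z u) \<in> N x" if x: "x \<in> ?A" "x \<prec> t" "u \<in> N x" for x t u
  proof -
    let ?w = "prepend x (at_nil u)" and ?q = "d 1 (prepend x (at_nil u))"
    have pu: "p u = u" by (rule p(3)) (rule NM[OF x(1,3)])
    have "?D ?w = at_nil u" by (rule chain_diff_prepend) (use finite_elts x in auto)
    \<comment> \<open>The homotopy identity for the copy of \<open>u\<close> in the component at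
      \<open>x\<close>.\<close>
    then have eq: "d 0 (at_nil (p u)) + ?D ?q = ?w"
      using homotopy[OF prepend_C1[OF x(1,3)]] pu by simp
    have "component ?V y = prepend y ` cycles L N 1 y" if "x \<prec> y" for y
      using rank_covered[OF that] x(1) minimal_component_Suc[of L UNIV N 1 y]
      by (simp add: minimal_complex_def del: minimal_component.simps cycles.simps)
    then have "sum_sub (component ?V) {y. x \<prec> y} = sum_sub (\<lambda>y. prepend y ` cycles L N 1 y) {y. x \<prec> y}"
      by (intro sum_sub_cong) blast
    moreover have "component ?V x = prepend x ` at_nil ` N x"
      using x(1) by (simp add: minimal_complex_def)
    ultimately have "?q \<in> sum_sub (\<lambda>y. prepend y ` cycles L N 1 y) {y. x \<prec> y}"
      using d1_cov[OF x(1), of ?w] x(3) by blast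
    then have q: "\<And>y. x \<prec> y \<Longrightarrow> tail y ?q \<in> cycles L N 1 y" "\<And>y. \<not> x \<prec> y \<Longrightarrow> tail y ?q = 0"
      by (simp_all add: sum_sub_prepend_iff del: cycles.simps)
    let ?g = "\<lambda>z. ?q [t, z]"
    \<comment> \<open>Evaluate this identity at the chain \<open>[z]\<close>. The right side
      vanishes there, and among the covers of \<open>x\<close> only \<open>t\<close> lies above
      \<open>z\<close>, so \<open>?q\<close> enters only through its component at
      \<open>t\<close>.\<close>
    have "\<delta> z u = - ?g z" if z: "z \<prec> t" "z \<noteq> x" for z
    proof -
      have "rk L z = 1" "z \<in> elts L" using rank_covered[OF z(1)] rank_covered[OF x(2)] x(1) covD(1)[OF z(1)] by auto
      then obtain y where y: "y \<prec> x" "y \<prec> z" using atoms_covered[of x z] x(1) by auto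
      have "?q [s, z] = 0" if "s \<noteq> t" for s
      proof (cases "x \<prec> s")
        case True
        then have "\<not> z \<prec> s" using common_cover_ex1[OF y] z x(2) that by blast
        then have "tail z (tail s ?q) = 0"
          using q(1)[OF True] unfolding One_nat_def cycles_Suc_iff by blast
        then show ?thesis by (metis tail_apply zero_fun_apply)
      next
        case False
        then show ?thesis using q(2) by (metis tail_apply zero_fun_apply)
      qed
      then have "?D ?q [z] = (\<Sum>s\<in>{t}. ?q [s, z])"
        unfolding chain_diff_def
        by (intro sum.mono_neutral_right) (use finite_elts covD(2)[OF x(2)] in auto)
      moreover have "\<delta> z u + ?D ?q [z] = 0"
        using fun_cong[OF eq, of "[z]"] z(2) unfolding plus_fun_apply \<delta>_def
        by (simp add: prepend_def)
      ultimately show ?thesis by (simp add: eq_neg_iff_add_eq_0)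
    qed
    then have "(\<Sum>z | z \<prec> t \<and> z \<noteq> x. \<delta> z u) = - (\<Sum>z | z \<prec> t \<and> z \<noteq> x. ?g z)"
      by (simp add: sum_negf[symmetric] cong: sum.cong_simp)
    \<comment> \<open>The component of \<open>?q\<close> at \<open>t\<close> comes from a cycle, so
      its entries cancel. The sum over \<open>z \<noteq> x\<close> is then, up to sign, the entry at
      \<open>x\<close>, which lies in \<open>N x\<close>.\<close>
    moreover have "(\<Sum>z | z \<prec> t. ?g z) = 0"
    proof -
      have c: "?D (tail t ?q) = 0" "\<And>z. \<not> z \<prec> t \<Longrightarrow> tail z (tail t ?q) = 0"
        using q(1)[OF x(2)] unfolding One_nat_def cycles_Suc_iff by blast+
      have "(\<Sum>z | z \<prec> t. ?g z) = (\<Sum>z | z \<prec> t. tail z (tail t ?q)) []"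
        by (simp add: sum_fun_apply tail_apply)
      also have "(\<Sum>z | z \<prec> t. tail z (tail t ?q)) = ?D (tail t ?q)"
        by (rule chain_diff_supported[symmetric]) (use c covD in auto)
      finally show ?thesis using c(1) by simp
    qed
    moreover have "(\<Sum>z | z \<prec> t. ?g z) = ?g x + (\<Sum>z | z \<prec> t \<and> z \<noteq> x. ?g z)"
    proof -
      have "{z. z \<prec> t \<and> z \<noteq> x} = {z. z \<prec> t} - {x}" by blast
      then show ?thesis using sum.remove[OF finite_cov(1), of x t ?g] x(2) by simp
    qed
    ultimately have "(\<Sum>z | z \<prec> t \<and> z \<noteq> x. \<delta> z u) = ?g x"
      by (simp only: eq_neg_iff_add_eq_0[symmetric])
    moreover have "?g x \<in> N x"
    proof -
      have "tail x (tail t ?q) \<in> cycles L N 0 x"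
        using q(1)[OF x(2)] x(2) unfolding One_nat_def cycles_Suc_iff by blast
      then obtain f where "f \<in> N x" "tail x (tail t ?q) = at_nil f" by auto
      then show ?thesis by (metis at_nil_Nil tail_apply)
    qed
    ultimately show ?thesis by simp
  qed
  have linear: "\<delta> a (u + v) = \<delta> a u + \<delta> a v" "\<delta> a (scale c u) = scale c (\<delta> a u)" for a u v c
  proof -
    interpret p: Vector_Spaces.linear scale scale p by (rule p(2))
    have "d 0 (at_nil (p u) + at_nil (p v)) = d 0 (at_nil (p u)) + d 0 (at_nil (p v))"
      "d 0 (pointwise scale c (at_nil (p u))) = pointwise scale c (d 0 (at_nil (p u)))"
      using d0[unfolded linear_between_def, THEN conjunct2, THEN conjunct1, rule_format, OF pM pM]
        d0[unfolded linear_between_def, THEN conjunct2, THEN conjunct2, rule_format, OF pM]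
      by (simp_all only:)
    then show "\<delta> a (u + v) = \<delta> a u + \<delta> a v" "\<delta> a (scale c u) = scale c (\<delta> a u)"
      unfolding \<delta>_def p.add p.scale at_nil_add at_nil_scale[OF module_axioms]
      by (simp_all add: pointwise_def)
  qed
  show thesis
  proof (rule that[of \<delta> p])
    show "\<forall>u. p (p u) = p u" using p(1,3) by blast
    show "\<forall>a u. a \<in> elts L \<longrightarrow> rk L a = 1 \<longrightarrow> u \<in> N a \<longrightarrow> p u = u"
      using NM p(3) by blast
  qed (use linear tail_d0(2) T part in auto)
qed

end

section \<open>Application to the arrangement\<close>

context finite_arrangement
begin

lemma subspace_perp: assumes "X \<in> elts L" shows "subspace (perp X)"
proof -
  have "X \<subseteq> dual_space scale" by (rule flat_subset) fact
  then have lin: "f (u + v) = f u + f v" "f (scale c u) = c * f u" if "f \<in> X" for f u v c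
    using that linear_dual[of f] by auto
  show ?thesis
  proof (rule subspaceI)
    show "0 \<in> perp X"
      unfolding perp_def using lin(2)[of _ 0 0] by simp
    show "u + v \<in> perp X" if "u \<in> perp X" "v \<in> perp X" for u v
      using that unfolding perp_def mem_Collect_eq by (metis lin(1) add_0)
    show "scale c u \<in> perp X" if "u \<in> perp X" for c u
      using that unfolding perp_def mem_Collect_eq by (metis lin(2) mult_zero_right)
  qed
qed

text \<open>The intersection of all hyperplanes is the top of the lattice, so a homotopy there is
  one for the whole complex.\<close>

lemma below_center: "below L (dual_space scale \<inter> \<Inter>\<H>) = L"
proof -
  have "{X \<in> elts L. leq L X (dual_space scale \<inter> \<Inter>\<H>)} = elts L"
    unfolding leq_flat by (auto simp: intersection_lattice_def)
  then show ?thesis by (simp add: below_def)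
qed

end

theorem corollary5p5:
  fixes scale :: "'k::field_char_0 \<Rightarrow> 'u::ab_group_add \<Rightarrow> 'u"
    and Basis :: "'u set"
    and \<H> :: "('u \<Rightarrow> 'k) set set"
    and \<kappa> :: "'k \<Rightarrow> 's::comm_ring_1"
    and \<iota> :: "'u \<Rightarrow> 's"
  assumes "finite_dimensional_vector_space scale Basis"
    and "arrangement scale \<H>"
    and "is_symmetric_algebra scale \<kappa> \<iota>"
    and "contractible (pointwise scale) (intersection_lattice scale \<H>) (relation_complex scale \<H>)"
  shows "exact_complex (intersection_lattice scale \<H>)
           (minimal_complex (intersection_lattice scale \<H>) UNIV (\<lambda>H. ideal_gen (\<iota> ` perp H)))"
proof -
  interpret finite_arrangement scale Basis \<H>
    by (intro finite_arrangement.intro finite_arrangement_axioms.intro assms(1,2))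
  interpret symmetric_algebra scale \<kappa> \<iota>
    by (intro symmetric_algebra.intro assms(3))
  let ?U = "\<lambda>H. ideal_gen (\<iota> ` perp H)"
  show ?thesis
  proof (cases "total_rank L \<ge> 1")
    \<comment> \<open>In total rank zero there is no degree in which exactness is asserted.\<close>
    case False
    then show ?thesis by (simp add: exact_complex_def)
  next
    case True
    have "dual_space scale \<inter> \<Inter>\<H> \<in> elts L" by (auto simp: intersection_lattice_def)
    then obtain d where d: "is_homotopy (pointwise scale) L (minimal_complex L UNIV perp) d"
      using assms(4) below_center unfolding contractible_def relation_complex_def by metis
    obtain \<delta> T where maps:
      "\<forall>a u v. \<delta> a (u + v) = \<delta> a u + \<delta> a v" "\<forall>a c u. \<delta> a (scale c u) = scale c (\<delta> a u)"
      "\<forall>a u. a \<in> elts L \<longrightarrow> rk L a = 1 \<longrightarrow> \<delta> a u \<in> perp a"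
      "\<forall>u. (\<Sum>a | a \<in> elts L \<and> rk L a = 1. \<delta> a u) = T u" "\<forall>u. T (T u) = T u"
      "\<forall>a u. a \<in> elts L \<longrightarrow> rk L a = 1 \<longrightarrow> u \<in> perp a \<longrightarrow> T u = u"
      "\<forall>x t u. x \<in> elts L \<longrightarrow> rk L x = 1 \<longrightarrow> covered_by L x t \<longrightarrow> u \<in> perp x \<longrightarrow>
        (\<Sum>z | covered_by L z t \<and> z \<noteq> x. \<delta> z u) \<in> perp x"
      by (rule euler_maps_of_homotopy[OF vector_space_axioms _ d True]) (rule subspace_perp)
    note \<delta> = maps(1-3)[rule_format] and T = maps(4-6)[rule_format] and part = maps(7)[rule_format]
    have "\<exists>D. derivation D \<and> (\<forall>u. D (\<iota> u) = \<iota> (\<delta> a u))" for a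
      by (rule derivation_exists) (fact \<delta>)+
    then obtain \<theta> where \<theta>: "\<And>a. derivation (\<theta> a)" "\<And>a u. \<theta> a (\<iota> u) = \<iota> (\<delta> a u)"
      by metis
    have sum_\<theta>: "(\<Sum>z\<in>Z. \<theta> z (\<iota> u)) = \<iota> (\<Sum>z\<in>Z. \<delta> z u)" for Z u
      unfolding \<theta>(2) by (rule additive.sum[OF additive_iota, symmetric])
    interpret euler_family L ?U \<theta>
    proof
      show "\<theta> a (f + g) = \<theta> a f + \<theta> a g" for a f g by (rule derivationD(5)[OF \<theta>(1)])
      show "\<theta> a f \<in> ?U a" if "a \<in> elts L" "rk L a = 1" for a f
        by (rule derivation_in_ideal[OF \<theta>(1)]) (simp add: \<theta>(2) \<delta>(3)[OF that] ideal_gen_base)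
      \<comment> \<open>The sum is itself a derivation, so it suffices to check generators of the
        ideal, where the claim reduces to the corresponding property of the linear maps.\<close>
      show "(\<Sum>z | covered_by L z t \<and> z \<noteq> x. \<theta> z f) \<in> ?U x"
        if "x \<in> elts L" "rk L x = 1" "covered_by L x t" "f \<in> ?U x" for x t f
      proof (rule derivation_preserves_ideal[OF _ _ that(4), of "\<lambda>f. \<Sum>z | covered_by L z t \<and> z \<noteq> x. \<theta> z f"])
        show "(\<Sum>z | covered_by L z t \<and> z \<noteq> x. \<theta> z b) \<in> ?U x" if "b \<in> \<iota> ` perp x" for b
          using that part[OF \<open>x \<in> elts L\<close> \<open>rk L x = 1\<close> \<open>covered_by L x t\<close>] sum_\<theta> by (auto intro!: ideal_gen_base)
      qed (rule derivation_sum, rule \<theta>(1))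
    qed (simp_all add: ideal_gen_0 ideal_gen_diff)
    \<comment> \<open>On the image of \<open>\<iota>\<close> the Euler operator is the projection
      \<open>T\<close>, as \<open>shifted_prod_ideal\<close> requires.\<close>
    have euler: "derivation euler" "\<And>u. euler (\<iota> u) = \<iota> (T u)"
      unfolding euler_def sum_\<theta> T(1) using derivation_sum[of _ \<theta>] \<theta>(1) by simp_all
    interpret euler_ring_family L ?U \<theta>
    proof
      \<comment> \<open>Characteristic zero enters here: the inverse is taken in the field and
        transported by \<open>\<kappa>\<close>.\<close>
      show "\<exists>c. c * of_nat (Suc k) = (1::'s)" for k
        using nat_unit[of "inverse (of_nat (Suc k))" "Suc k"] by (metis left_inverse of_nat_neq_0)
      show "\<exists>N. shifted_prod euler N f = 0" if "x \<in> elts L" "rk L x = 1" "f \<in> ?U x" for x f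
        by (rule shifted_prod_ideal[OF euler(1) euler(2) T(2) _ that(3)]) (rule T(3)[OF that(1,2)])
    qed (simp_all add: subspace_ideal_gen)
    show ?thesis by (rule exact_minimal_complex)
  qed
qed

end
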